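(* Let $\beta\in\mathbb C$ with $\beta^4=-1$, and let $Z$ be the centre of the quasi-Hopf algebra $Q=\overline{U}_{\mathrm i}s\ell(2)$ (with R-matrix as in the context). The operators $\mathscr S,\mathscr T:Z\to Z$, $$\mathscr S(a)=\boldsymbol\phi(\boldsymbol\chi^{-1}(a)),\qquad\mathscr T(a)=b\,\mathscr S^{-1}(\boldsymbol v\,\mathscr S(a)),\qquad b=\beta^2e^{2\pi\mathrm i/3},$$ define an action of $SL(2,\mathbb Z)$ on $Z$, and $Z$ decomposes under it as $\mathbb C^2\oplus\mathbb C^3$: there is a basis $\boldsymbol\rho,\boldsymbol\varphi$ of the first summand and a basis $\boldsymbol\varkappa_0,\boldsymbol\varkappa_1,\boldsymbol\varkappa_2$ of the second such that $$\mathscr S(\boldsymbol\rho)=-\mathrm i\boldsymbol\varphi,\quad\mathscr S(\boldsymbol\varphi)=\mathrm i\boldsymbol\rho,\quad\mathscr T(\boldsymbol\rho)=b\boldsymbol\rho,\quad\mathscr T(\boldsymbol\varphi)=b(\boldsymbol\varphi-\mathrm i\beta^{-2}\boldsymbol\rho),$$ $$\mathscr S(\boldsymbol\varkappa_0)=\tfrac12(\boldsymbol\varkappa_0-2\boldsymbol\varkappa_1+\boldsymbol\varkappa_2),\quad\mathscr S(\boldsymbol\varkappa_1)=\tfrac12(\boldsymbol\varkappa_2-\boldsymbol\varkappa_0),\quad\mathscr S(\boldsymbol\varkappa_2)=\tfrac12(\boldsymbol\varkappa_0+2\boldsymbol\varkappa_1+\boldsymbol\varkappa_2),$$ $$\mathscr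 T(\boldsymbol\varkappa_0)=-b\beta\,\boldsymbol\varkappa_0,\quad\mathscr T(\boldsymbol\varkappa_1)=b\,\boldsymbol\varkappa_1,\quad\mathscr T(\boldsymbol\varkappa_2)=b\beta\,\boldsymbol\varkappa_2.$$ At $\beta=e^{-\mathrm i\pi/4}$ this action is equivalent to the standard $SL(2,\mathbb Z)$-representation of Feigin–Gainutdinov–Semikhatov–Tipunin (FGST) at $p=2$ (described in the context).
   Context: $Q=\overline{U}_{\mathrm i}s\ell(2)$ is the associative unital $\mathbb C$-algebra with generators $E,F,K^{\pm1}$ and relations $KEK^{-1}=-E$, $KFK^{-1}=-F$, $[E,F]=\frac{K-K^{-1}}{2\mathrm i}$, $E^2=F^2=0$, $K^4=1$ (dimension 16), with $\Delta(E)=1\otimes E+E\otimes K$, $\Delta(F)=K^{-1}\otimes F+F\otimes 1$, $\Delta(K)=K\otimes K$, $\epsilon(E)=\epsilon(F)=0$, $\epsilon(K)=1$, $S(E)=-EK^{-1}$, $S(F)=-KF$, $S(K)=K^{-1}$. Put $e_0=\frac12(1+K^2)$, $e_1=\frac12(1-K^2)$, $C=FE-\frac{\mathrm i}4(K-K^{-1})$. $Q$ is a quasi-triangular quasi-Hopf algebra with a coassociator $\Phi$ (not needed for the statement) and R-matrix $R=R^{00}e_0\otimes e_0+R^{01}e_0\otimes e_1+R^{10}e_1\otimes e_0+R^{11}e_1\otimes e_1$, where $R^{00}=\frac12(1\otimes1+1\otimes K+K\otimes1-K\otimes K)\{1\otimes1+2\mathrm i\,E\otimes F\}$, $R^{01}=\frac12(1\otimes1-\mathrm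 i\,1\otimes K+K\otimes1+\mathrm i\,K\otimes K)\{1\otimes1+(1-\mathrm i)FK\otimes EK-(1-\mathrm i)E\otimes F+(1+\mathrm i)EFK\otimes1+2\mathrm i\,EFK\otimes EFK\}$, $R^{10}=\frac12(1\otimes1+1\otimes K-\mathrm i\,K\otimes1+\mathrm i\,K\otimes K)\{1\otimes K+(1-\mathrm i)FK\otimes E+(1-\mathrm i)E\otimes FK-(1-\mathrm i)1\otimes EF-2\mathrm i\,EFK\otimes EF\}$, $R^{11}=\frac\beta2(1\otimes1-\mathrm i\,1\otimes K-\mathrm i\,K\otimes1+K\otimes K)\{-\mathrm i\,K\otimes1+2\mathrm i\,EK\otimes F+(1-\mathrm i)K\otimes EFK-(1+\mathrm i)EF\otimes1-2\mathrm i\,EF\otimes EFK\}$. Monodromy matrix: $M=R_{21}R$. Ribbon element: $\boldsymbol v=e_0+\beta(e_1^+-e_1^-)+2\mathrm i(w^+-w^-)$ with $e_1^\pm=(\frac12\pm C)e_1$, $w^\pm=\frac12EF(1\pm K)e_0$. Drinfeld map $\boldsymbol\chi:Q^*\to Q$, $\boldsymbol\chi(\varphi)=(\varphi\otimes\mathrm{id})(M)$. Cointegral $\boldsymbol c=\frac{\beta^2}{\mathrm i}EF\sum_{j=0}^3K^j$. Radford map $\boldsymbol\phi:Q^*\to Q$, $\boldsymbol\phi(\varphi)=\sum_{(\boldsymbol c)}\varphi(\boldsymbol c')\boldsymbol c''$, where $\Delta(\boldsymbol c)=\sum\boldsymbol c'\otimes\boldsymbol c''$. The generators $S=\begin{pmatrix}0&-1\\1&0\end{pmatrix}$,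 $T=\begin{pmatrix}1&1\\0&1\end{pmatrix}$ of $SL(2,\mathbb Z)$ act by $\mathscr S$ and $\mathscr T$; the relations satisfied are $\mathscr S^2=\mathrm{id}$ and $(\mathscr S\mathscr T)^3=\mathrm{id}$. The FGST representation at $p=2$ is five-dimensional with basis $\rho(1),\varphi(1),\varkappa(0),\varkappa(1),\varkappa(2)$ and action $S\rho(1)=-\mathrm i\varphi(1)$, $S\varphi(1)=\mathrm i\rho(1)$, $T\rho(1)=e^{\mathrm i\pi/6}\rho(1)$, $T\varphi(1)=e^{\mathrm i\pi/6}(\varphi(1)+\rho(1))$, $S\varkappa(0)=\frac12(\varkappa(0)-2\varkappa(1)+\varkappa(2))$, $S\varkappa(1)=\frac12(\varkappa(2)-\varkappa(0))$, $S\varkappa(2)=\frac12(\varkappa(0)+2\varkappa(1)+\varkappa(2))$, $T\varkappa(0)=-e^{-\mathrm i\pi/12}\varkappa(0)$, $T\varkappa(1)=e^{\mathrm i\pi/6}\varkappa(1)$, $T\varkappa(2)=e^{-\mathrm i\pi/12}\varkappa(2)$. *)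

theory Defs
  imports "HOL-Analysis.Analysis" "HOL-Library.Multiset"
begin

class scaleC =
  fixes scaleC :: "complex \<Rightarrow> 'a \<Rightarrow> 'a" (infixr "*\<^sub>C" 75)

(* Associative unital complex algebras; the zero algebra is allowed. *)
class complex_algebra = scaleC + ring + monoid_mult +
  assumes scaleC_add_right: "c *\<^sub>C (x + y) = c *\<^sub>C x + c *\<^sub>C y"
    and scaleC_add_left: "(c + d) *\<^sub>C x = c *\<^sub>C x + d *\<^sub>C x"
    and scaleC_scaleC: "c *\<^sub>C d *\<^sub>C x = (c * d) *\<^sub>C x"
    and scaleC_one: "1 *\<^sub>C x = x"
    and mult_scaleC_left: "(c *\<^sub>C x) * y = c *\<^sub>C (x * y)"
    and mult_scaleC_right: "x * (c *\<^sub>C y) = c *\<^sub>C (x * y)"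

global_interpretation cvs: vector_space "scaleC :: complex \<Rightarrow> 'a \<Rightarrow> 'a::complex_algebra"
  by standard (simp_all add: scaleC_add_right scaleC_add_left scaleC_scaleC scaleC_one)

definition centre :: "'a::complex_algebra set" where
  "centre = {z. \<forall>x. z * x = x * z}"

typedef (overloaded) 'a dual =
  "{f :: 'a::complex_algebra \<Rightarrow> complex. Vector_Spaces.linear scaleC (*) f}"
  morphisms dual_apply Abs_dual
proof
  show "(\<lambda>_. 0) \<in> {f :: 'a \<Rightarrow> complex. Vector_Spaces.linear scaleC (*) f}"
    by (auto intro!: Vector_Spaces.linear.intro module_hom.intro module_hom_axioms.intro
        cvs.vector_space_axioms vector_space.intro cvs.module_axioms module.intro
        simp: algebra_simps)
qed

setup_lifting type_definition_dual

(* A multiset {# (a1, b1), ..., (an, bn) #} stands for the formal sum of the a_i (x) b_i;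
   tensor_eq is the congruence generated by bilinearity over the complex numbers.
   Negatives exist in the quotient since (a, b) + (-a, b) is equivalent to (0, b), hence to 0. *)
inductive tensor_eq ::
  "('a::complex_algebra \<times> 'b::complex_algebra) multiset \<Rightarrow> ('a \<times> 'b) multiset \<Rightarrow> bool"
where
  refl: "tensor_eq A A"
| sym: "tensor_eq A B \<Longrightarrow> tensor_eq B A"
| trans: "tensor_eq A B \<Longrightarrow> tensor_eq B C \<Longrightarrow> tensor_eq A C"
| plus: "tensor_eq A B \<Longrightarrow> tensor_eq C D \<Longrightarrow> tensor_eq (A + C) (B + D)"
| add_left: "tensor_eq {#(a + a', b)#} {#(a, b), (a', b)#}"
| add_right: "tensor_eq {#(a, b + b')#} {#(a, b), (a, b')#}"
| scale: "tensor_eq {#(c *\<^sub>C a, b)#} {#(a, c *\<^sub>C b)#}"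
| zero: "tensor_eq {#(0, b)#} {#}"

lemma tensor_eq_equivp: "equivp tensor_eq"
proof (rule equivpI)
  show "reflp tensor_eq" by (rule reflpI) (rule tensor_eq.refl)
  show "symp tensor_eq" by (rule sympI) (rule tensor_eq.sym)
  show "transp tensor_eq" by (rule transpI) (rule tensor_eq.trans)
qed

quotient_type (overloaded) ('a, 'b) tensor =
  "('a::complex_algebra \<times> 'b::complex_algebra) multiset" / tensor_eq
  by (rule tensor_eq_equivp)

lift_definition pure_tensor ::
    "'a::complex_algebra \<Rightarrow> 'b::complex_algebra \<Rightarrow> ('a, 'b) tensor" (infix "\<otimes>" 72)
  is "\<lambda>a b. {#(a, b)#}" .

lemma tensor_eq_image:
  assumes "tensor_eq A B"
    and "\<And>a a' b. tensor_eq {#f (a + a', b)#} {#f (a, b), f (a', b)#}"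
    and "\<And>a b b'. tensor_eq {#f (a, b + b')#} {#f (a, b), f (a, b')#}"
    and "\<And>c a b. tensor_eq {#f (c *\<^sub>C a, b)#} {#f (a, c *\<^sub>C b)#}"
    and "\<And>b. tensor_eq {#f (0, b)#} {#}"
  shows "tensor_eq (image_mset f A) (image_mset f B)"
  using assms(1)
proof (induction rule: tensor_eq.induct)
  case (sym A B)
  from sym.IH show ?case by (rule tensor_eq.sym)
next
  case (trans A B C)
  from trans.IH show ?case by (rule tensor_eq.trans)
next
  case (plus A B C D)
  from tensor_eq.plus[OF plus.IH] show ?case by simp
qed (use assms(2-) in \<open>simp_all add: tensor_eq.refl\<close>)

definition tensor_mult_pair ::
    "'a::complex_algebra \<times> 'b::complex_algebra \<Rightarrow> 'a \<times> 'b \<Rightarrow> 'a \<times> 'b" where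
  "tensor_mult_pair x y = (fst x * fst y, snd x * snd y)"

lemma tensor_mult_pair_assoc:
  "tensor_mult_pair (tensor_mult_pair x y) = (\<lambda>z. tensor_mult_pair x (tensor_mult_pair y z))"
  by (simp add: fun_eq_iff tensor_mult_pair_def mult.assoc)

definition tensor_mult_raw ::
    "('a::complex_algebra \<times> 'b::complex_algebra) multiset \<Rightarrow> ('a \<times> 'b) multiset \<Rightarrow> ('a \<times> 'b) multiset" where
  "tensor_mult_raw A B = (\<Sum>x\<in>#A. image_mset (tensor_mult_pair x) B)"

lemma tensor_mult_raw_simps [simp]:
  "tensor_mult_raw {#} B = {#}"
  "tensor_mult_raw (add_mset x A) B = image_mset (tensor_mult_pair x) B + tensor_mult_raw A B"
  "tensor_mult_raw (A + A') B = tensor_mult_raw A B + tensor_mult_raw A' B"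
  by (simp_all add: tensor_mult_raw_def)

lemma tensor_mult_raw_right [simp]:
  "tensor_mult_raw A {#} = {#}"
  "tensor_mult_raw A (add_mset y B) = image_mset (\<lambda>x. tensor_mult_pair x y) A + tensor_mult_raw A B"
  "tensor_mult_raw A (B + B') = tensor_mult_raw A B + tensor_mult_raw A B'"
  by (induction A) simp_all

lemma tensor_mult_raw_cong_right:
  assumes "tensor_eq B B'" shows "tensor_eq (tensor_mult_raw A B) (tensor_mult_raw A B')"
proof (induction A)
  case empty
  show ?case by (simp add: tensor_eq.refl)
next
  case (add x A)
  have "tensor_eq (image_mset (tensor_mult_pair x) B) (image_mset (tensor_mult_pair x) B')"
    by (rule tensor_eq_image[OF assms])
      (auto simp: tensor_mult_pair_def distrib_left mult_scaleC_right intro: tensor_eq.add_left tensor_eq.add_right tensor_eq.scale tensor_eq.zero)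
  with add show ?case by (auto intro: tensor_eq.plus)
qed

lemma tensor_mult_raw_cong_left:
  assumes "tensor_eq A A'" shows "tensor_eq (tensor_mult_raw A B) (tensor_mult_raw A' B)"
proof (induction B)
  case empty
  show ?case by (simp add: tensor_eq.refl)
next
  case (add x B)
  have "tensor_eq (image_mset (\<lambda>y. tensor_mult_pair y x) A) (image_mset (\<lambda>y. tensor_mult_pair y x) A')"
    by (rule tensor_eq_image[OF assms])
      (auto simp: tensor_mult_pair_def distrib_right mult_scaleC_left intro: tensor_eq.add_left tensor_eq.add_right tensor_eq.scale tensor_eq.zero)
  with add show ?case by (auto intro: tensor_eq.plus)
qed

lemma tensor_mult_raw_assoc:
  "tensor_mult_raw (tensor_mult_raw A B) C = tensor_mult_raw A (tensor_mult_raw B C)"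
proof -
  have *: "tensor_mult_raw (image_mset (tensor_mult_pair x) B) C
      = image_mset (tensor_mult_pair x) (tensor_mult_raw B C)" for x
    by (induction B)
      (simp_all add: multiset.map_comp comp_def tensor_mult_pair_assoc)
  show ?thesis by (induction A) (simp_all add: *)
qed

lemma tensor_scale_right_zero: "tensor_eq {#(a, 0)#} {#}"
proof -
  have "tensor_eq {#(a, 0 *\<^sub>C 0)#} {#(0 *\<^sub>C a, 0)#}"
    by (rule tensor_eq.sym) (rule tensor_eq.scale)
  then have "tensor_eq {#(a, 0)#} {#(0, 0)#}" by simp
  then show ?thesis by (rule tensor_eq.trans[OF _ tensor_eq.zero])
qed

lemma tensor_eq_scale_raw:
  assumes "tensor_eq A B"
  shows "tensor_eq (image_mset (\<lambda>(a, b). (c *\<^sub>C a, b)) A) (image_mset (\<lambda>(a, b). (c *\<^sub>C a, b)) B)"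
proof (rule tensor_eq_image[OF assms])
  fix d and a :: 'a and b :: 'b
  have "tensor_eq {#(d *\<^sub>C c *\<^sub>C a, b)#} {#(c *\<^sub>C a, d *\<^sub>C b)#}" by (rule tensor_eq.scale)
  then show "tensor_eq {#case (d *\<^sub>C a, b) of (a, b) \<Rightarrow> (c *\<^sub>C a, b)#}
      {#case (a, d *\<^sub>C b) of (a, b) \<Rightarrow> (c *\<^sub>C a, b)#}"
    by (simp add: mult.commute)
qed (auto simp: scaleC_add_right intro: tensor_eq.add_left tensor_eq.add_right tensor_eq.scale tensor_eq.zero)

instantiation tensor :: (complex_algebra, complex_algebra) complex_algebra
begin

lift_definition zero_tensor :: "('a, 'b) tensor" is "{#}" .

lift_definition one_tensor :: "('a, 'b) tensor" is "{#(1, 1)#}" .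

lift_definition plus_tensor :: "('a, 'b) tensor \<Rightarrow> ('a, 'b) tensor \<Rightarrow> ('a, 'b) tensor" is "(+)"
  by (rule tensor_eq.plus)

lift_definition scaleC_tensor :: "complex \<Rightarrow> ('a, 'b) tensor \<Rightarrow> ('a, 'b) tensor"
  is "\<lambda>c. image_mset (\<lambda>(a, b). (c *\<^sub>C a, b))"
  by (rule tensor_eq_scale_raw)

lift_definition times_tensor :: "('a, 'b) tensor \<Rightarrow> ('a, 'b) tensor \<Rightarrow> ('a, 'b) tensor"
  is tensor_mult_raw
  by (rule tensor_eq.trans[OF tensor_mult_raw_cong_left tensor_mult_raw_cong_right])

definition uminus_tensor :: "('a, 'b) tensor \<Rightarrow> ('a, 'b) tensor" where
  "uminus_tensor x = (- 1) *\<^sub>C x"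

definition minus_tensor :: "('a, 'b) tensor \<Rightarrow> ('a, 'b) tensor \<Rightarrow> ('a, 'b) tensor" where
  "minus_tensor x y = x + - y"

instance
proof
  fix x y z :: "('a, 'b) tensor" and c d :: complex
  show "x + y + z = x + (y + z)" by transfer (simp add: add.assoc tensor_eq.refl)
  show "x + y = y + x" by transfer (simp add: add.commute tensor_eq.refl)
  show "0 + x = x" by transfer (simp add: tensor_eq.refl)
  show "x - y = x + - y" by (simp add: minus_tensor_def)
  show "x * y * z = x * (y * z)" by transfer (simp add: tensor_mult_raw_assoc tensor_eq.refl)
  show "(x + y) * z = x * z + y * z" by transfer (simp add: tensor_eq.refl)
  show "x * (y + z) = x * y + x * z" by transfer (simp add: tensor_eq.refl)
  show "1 * x = x"
    by transfer (simp add: tensor_mult_pair_def[abs_def] tensor_eq.refl)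
  show "x * 1 = x"
    by transfer (simp add: tensor_mult_pair_def tensor_eq.refl)
  show "c *\<^sub>C (x + y) = c *\<^sub>C x + c *\<^sub>C y" by transfer (simp add: tensor_eq.refl)
  show "c *\<^sub>C d *\<^sub>C x = (c * d) *\<^sub>C x"
    by transfer
      (simp add: multiset.map_comp comp_def case_prod_unfold scaleC_scaleC tensor_eq.refl)
  show "1 *\<^sub>C x = x" by transfer (simp add: scaleC_one case_prod_unfold tensor_eq.refl)
  show add: "(c + d) *\<^sub>C x = c *\<^sub>C x + d *\<^sub>C x" for c d and x :: "('a, 'b) tensor"
  proof (transfer)
    fix c d :: complex and A :: "('a \<times> 'b) multiset"
    show "tensor_eq (image_mset (\<lambda>(a, b). ((c + d) *\<^sub>C a, b)) A)
       (image_mset (\<lambda>(a, b). (c *\<^sub>C a, b)) A + image_mset (\<lambda>(a, b). (d *\<^sub>C a, b)) A)"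
    proof (induction A)
      case empty
      show ?case by (simp add: tensor_eq.refl)
    next
      case (add x A)
      obtain a b where x: "x = (a, b)" by force
      from tensor_eq.plus[OF tensor_eq.add_left[of "c *\<^sub>C a" "d *\<^sub>C a" b] add]
      show ?case by (simp add: x scaleC_add_left ac_simps add_mset_commute)
    qed
  qed
  have "0 *\<^sub>C x = (0 :: ('a, 'b) tensor)"
  proof transfer
    fix A :: "('a \<times> 'b) multiset"
    show "tensor_eq (image_mset (\<lambda>(a, b). (0 *\<^sub>C a, b)) A) {#}"
    proof (induction A)
      case empty
      show ?case by (simp add: tensor_eq.refl)
    next
      case (add x A)
      obtain a b where x: "x = (a, b)" by force
      from tensor_eq.plus[OF tensor_eq.zero[of b] add]
      show ?case by (simp add: x)
    qed
  qed
  then show "- x + x = 0"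
    unfolding uminus_tensor_def using add[of "-1" 1 x] \<open>1 *\<^sub>C x = x\<close> by simp
  show "(c *\<^sub>C x) * y = c *\<^sub>C (x * y)"
  proof transfer
    fix c and A B :: "('a \<times> 'b) multiset"
    show "tensor_eq (tensor_mult_raw (image_mset (\<lambda>(a, b). (c *\<^sub>C a, b)) A) B)
       (image_mset (\<lambda>(a, b). (c *\<^sub>C a, b)) (tensor_mult_raw A B))"
      by (induction A) (simp_all add: multiset.map_comp comp_def case_prod_unfold
          tensor_mult_pair_def[abs_def] mult_scaleC_left tensor_eq.refl tensor_eq.plus[OF tensor_eq.refl])
  qed
  show "x * (c *\<^sub>C y) = c *\<^sub>C (x * y)"
  proof transfer
    fix c and A B :: "('a \<times> 'b) multiset"
    show "tensor_eq (tensor_mult_raw A (image_mset (\<lambda>(a, b). (c *\<^sub>C a, b)) B))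
       (image_mset (\<lambda>(a, b). (c *\<^sub>C a, b)) (tensor_mult_raw A B))"
      by (induction A) (simp_all add: multiset.map_comp comp_def case_prod_unfold
          tensor_mult_pair_def[abs_def] mult_scaleC_right tensor_eq.refl tensor_eq.plus[OF tensor_eq.refl])
  qed
qed

end

lemma pure_tensor_mult: "(a \<otimes> b) * (c \<otimes> d) = (a * c) \<otimes> (b * d)"
  by transfer (simp add: tensor_mult_pair_def tensor_eq.refl)

lemma pure_tensor_one: "1 \<otimes> 1 = 1"
  by transfer (rule tensor_eq.refl)

lemma pure_tensor_add_left: "(a + a') \<otimes> b = a \<otimes> b + a' \<otimes> b"
  by transfer (simp add: tensor_eq.add_left add_mset_commute)

lemma pure_tensor_add_right: "a \<otimes> (b + b') = a \<otimes> b + a \<otimes> b'"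
  by transfer (simp add: tensor_eq.add_right add_mset_commute)

lemma pure_tensor_scaleC_left: "(c *\<^sub>C a) \<otimes> b = c *\<^sub>C (a \<otimes> b)"
  by transfer (simp add: tensor_eq.refl)

lemma pure_tensor_scaleC_right: "a \<otimes> (c *\<^sub>C b) = c *\<^sub>C (a \<otimes> b)"
  by transfer (simp add: tensor_eq.scale tensor_eq.sym)

lemma pure_tensor_zero: "0 \<otimes> b = 0" "a \<otimes> 0 = 0"
  by (transfer, simp add: tensor_eq.zero tensor_scale_right_zero)+

lift_definition tensor_flip ::
    "('a::complex_algebra, 'b::complex_algebra) tensor \<Rightarrow> ('b, 'a) tensor"
  is "image_mset (\<lambda>(a, b). (b, a))"
  by (erule tensor_eq_image)
    (simp_all only: prod.case tensor_eq.add_left tensor_eq.add_right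
      tensor_eq.sym[OF tensor_eq.scale] tensor_scale_right_zero)

(* The map (f (x) id), with values in the complex numbers tensored with 'b,
   i.e. in 'b: it sends a (x) b to f(a) b. *)
lift_definition tensor_contract ::
    "'a::complex_algebra dual \<Rightarrow> ('a, 'b::complex_algebra) tensor \<Rightarrow> 'b"
  is "\<lambda>f A. (\<Sum>(a, b)\<in>#A. f a *\<^sub>C b)"
proof -
  fix f :: "'a \<Rightarrow> complex" and A B :: "('a \<times> 'b) multiset"
  assume "Vector_Spaces.linear scaleC (*) f"
  then interpret f: Vector_Spaces.linear scaleC "(*)" f .
  assume "tensor_eq A B"
  then show "(\<Sum>(a, b)\<in>#A. f a *\<^sub>C b) = (\<Sum>(a, b)\<in>#B. f a *\<^sub>C b)"
    by induction (simp_all add: f.add f.scale f.zero scaleC_add_left scaleC_add_right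
        scaleC_scaleC mult.commute)
qed

(* The restricted quantum group of sl(2) at q = i. Qterm consists of noncommutative polynomial
   expressions in the four generators; Qrel is the congruence generated by the axioms of a unital
   complex algebra and the defining relations, so that the quotient is the algebra presented by
   these generators and relations. Additive inverses come from Mul_0_left, as (-1) x + x is
   congruent to 0 x. *)
datatype Qterm = Scal complex | GE | GF | GK | GKinv | Add Qterm Qterm | Mul Qterm Qterm

inductive Qrel :: "Qterm \<Rightarrow> Qterm \<Rightarrow> bool" where
  refl: "Qrel x x"
| sym: "Qrel x y \<Longrightarrow> Qrel y x"
| trans: "Qrel x y \<Longrightarrow> Qrel y z \<Longrightarrow> Qrel x z"
| Add_cong: "Qrel x x' \<Longrightarrow> Qrel y y' \<Longrightarrow> Qrel (Add x y) (Add x' y')"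
| Mul_cong: "Qrel x x' \<Longrightarrow> Qrel y y' \<Longrightarrow> Qrel (Mul x y) (Mul x' y')"
| Add_assoc: "Qrel (Add (Add x y) z) (Add x (Add y z))"
| Add_commute: "Qrel (Add x y) (Add y x)"
| Add_0: "Qrel (Add (Scal 0) x) x"
| Mul_assoc: "Qrel (Mul (Mul x y) z) (Mul x (Mul y z))"
| Mul_0_left: "Qrel (Mul (Scal 0) x) (Scal 0)"
| Mul_1_left: "Qrel (Mul (Scal 1) x) x"
| Mul_Add_left: "Qrel (Mul x (Add y z)) (Add (Mul x y) (Mul x z))"
| Mul_Add_right: "Qrel (Mul (Add x y) z) (Add (Mul x z) (Mul y z))"
| Scal_Add: "Qrel (Scal (c + d)) (Add (Scal c) (Scal d))"
| Scal_Mul: "Qrel (Scal (c * d)) (Mul (Scal c) (Scal d))"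
| Scal_central: "Qrel (Mul x (Scal c)) (Mul (Scal c) x)"
| K_Kinv: "Qrel (Mul GK GKinv) (Scal 1)"
| Kinv_K: "Qrel (Mul GKinv GK) (Scal 1)"
| KEKinv: "Qrel (Mul (Mul GK GE) GKinv) (Mul (Scal (-1)) GE)"
| KFKinv: "Qrel (Mul (Mul GK GF) GKinv) (Mul (Scal (-1)) GF)"
| EF_commutator: "Qrel (Add (Mul GE GF) (Mul (Scal (-1)) (Mul GF GE)))
    (Mul (Scal (1 / (2 * \<i>))) (Add GK (Mul (Scal (-1)) GKinv)))"
| E_square: "Qrel (Mul GE GE) (Scal 0)"
| F_square: "Qrel (Mul GF GF) (Scal 0)"
| K_fourth: "Qrel (Mul GK (Mul GK (Mul GK GK))) (Scal 1)"

lemma Qrel_equivp: "equivp Qrel"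
proof (rule equivpI)
  show "reflp Qrel" by (rule reflpI) (rule Qrel.refl)
  show "symp Qrel" by (rule sympI) (rule Qrel.sym)
  show "transp Qrel" by (rule transpI) (rule Qrel.trans)
qed

quotient_type Q = Qterm / Qrel
  by (rule Qrel_equivp)

instantiation Q :: complex_algebra
begin

lift_definition zero_Q :: Q is "Scal 0" .
lift_definition one_Q :: Q is "Scal 1" .
lift_definition plus_Q :: "Q \<Rightarrow> Q \<Rightarrow> Q" is Add by (rule Qrel.Add_cong)
lift_definition times_Q :: "Q \<Rightarrow> Q \<Rightarrow> Q" is Mul by (rule Qrel.Mul_cong)
lift_definition scaleC_Q :: "complex \<Rightarrow> Q \<Rightarrow> Q" is "\<lambda>c. Mul (Scal c)"
  by (rule Qrel.Mul_cong[OF Qrel.refl])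
definition uminus_Q :: "Q \<Rightarrow> Q" where "uminus_Q x = (-1) *\<^sub>C x"
definition minus_Q :: "Q \<Rightarrow> Q \<Rightarrow> Q" where "minus_Q x y = x + - y"

instance
proof
  fix x y z :: Q and c d :: complex
  show "x + y + z = x + (y + z)" by transfer (rule Qrel.Add_assoc)
  show "x + y = y + x" by transfer (rule Qrel.Add_commute)
  show "0 + x = x" by transfer (rule Qrel.Add_0)
  show "x - y = x + - y" by (simp add: minus_Q_def)
  show "x * y * z = x * (y * z)" by transfer (rule Qrel.Mul_assoc)
  show "(x + y) * z = x * z + y * z" by transfer (rule Qrel.Mul_Add_right)
  show "x * (y + z) = x * y + x * z" by transfer (rule Qrel.Mul_Add_left)
  show one: "1 * x = x" by transfer (rule Qrel.Mul_1_left)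
  show "x * 1 = x" by transfer (blast intro: Qrel.intros)
  show "c *\<^sub>C (x + y) = c *\<^sub>C x + c *\<^sub>C y" by transfer (rule Qrel.Mul_Add_left)
  show add: "(c + d) *\<^sub>C x = c *\<^sub>C x + d *\<^sub>C x" for c d
    by transfer (rule Qrel.trans[OF Qrel.Mul_cong[OF Qrel.Scal_Add Qrel.refl] Qrel.Mul_Add_right])
  show "c *\<^sub>C d *\<^sub>C x = (c * d) *\<^sub>C x"
    by transfer (meson Qrel.Mul_assoc Qrel.Mul_cong Qrel.Scal_Mul Qrel.refl Qrel.sym Qrel.trans)
  show scale_one: "1 *\<^sub>C x = x" by transfer (rule Qrel.Mul_1_left)
  show "(c *\<^sub>C x) * y = c *\<^sub>C (x * y)" by transfer (rule Qrel.Mul_assoc)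
  show "x * (c *\<^sub>C y) = c *\<^sub>C (x * y)"
    by transfer (meson Qrel.Mul_assoc Qrel.Mul_cong Qrel.Scal_central Qrel.refl Qrel.sym Qrel.trans)
  have "0 *\<^sub>C x = 0" by transfer (rule Qrel.Mul_0_left)
  then show "- x + x = 0"
    unfolding uminus_Q_def using add[of "-1" 1] scale_one by simp
qed

end

lift_definition E\<^sub>Q :: Q is GE .
lift_definition F\<^sub>Q :: Q is GF .
lift_definition K\<^sub>Q :: Q is GK .
lift_definition Kinv\<^sub>Q :: Q is GKinv .

lemma Q_relations:
  "K\<^sub>Q * Kinv\<^sub>Q = 1" "Kinv\<^sub>Q * K\<^sub>Q = 1"
  "K\<^sub>Q * E\<^sub>Q * Kinv\<^sub>Q = - E\<^sub>Q"
  "K\<^sub>Q * F\<^sub>Q * Kinv\<^sub>Q = - F\<^sub>Q"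
  "E\<^sub>Q * F\<^sub>Q - F\<^sub>Q * E\<^sub>Q = (1 / (2 * \<i>)) *\<^sub>C (K\<^sub>Q - Kinv\<^sub>Q)"
  "E\<^sub>Q * E\<^sub>Q = 0" "F\<^sub>Q * F\<^sub>Q = 0" "K\<^sub>Q ^ 4 = 1"
proof -
  show "E\<^sub>Q * F\<^sub>Q - F\<^sub>Q * E\<^sub>Q = (1 / (2 * \<i>)) *\<^sub>C (K\<^sub>Q - Kinv\<^sub>Q)"
    unfolding minus_Q_def uminus_Q_def by transfer (rule Qrel.EF_commutator)
  have "K\<^sub>Q * (K\<^sub>Q * (K\<^sub>Q * K\<^sub>Q)) = 1" by transfer (rule Qrel.K_fourth)
  then show "K\<^sub>Q ^ 4 = 1" by (simp add: power4_eq_xxxx mult.assoc)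
  show "K\<^sub>Q * E\<^sub>Q * Kinv\<^sub>Q = - E\<^sub>Q" "K\<^sub>Q * F\<^sub>Q * Kinv\<^sub>Q = - F\<^sub>Q"
    unfolding uminus_Q_def by (transfer, rule Qrel.KEKinv Qrel.KFKinv)+
qed (transfer, rule Qrel.K_Kinv Qrel.Kinv_K Qrel.E_square Qrel.F_square)+

primrec Qeval :: "'a::complex_algebra \<Rightarrow> 'a \<Rightarrow> 'a \<Rightarrow> 'a \<Rightarrow> Qterm \<Rightarrow> 'a" where
  "Qeval e f k l (Scal c) = c *\<^sub>C 1"
| "Qeval e f k l GE = e"
| "Qeval e f k l GF = f"
| "Qeval e f k l GK = k"
| "Qeval e f k l GKinv = l"
| "Qeval e f k l (Add x y) = Qeval e f k l x + Qeval e f k l y"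
| "Qeval e f k l (Mul x y) = Qeval e f k l x * Qeval e f k l y"

lemma Qeval_cong:
  assumes "Qrel x y" and "k * l = 1" "l * k = 1" "k * e * l = - e" "k * f * l = - f"
    "e * f - f * e = (1 / (2 * \<i>)) *\<^sub>C (k - l)" "e * e = 0" "f * f = 0" "k ^ 4 = 1"
  shows "Qeval e f k l x = Qeval e f k l y"
  using assms(1)
proof induction
  case EF_commutator
  show ?case using assms(6) by (simp add: mult_scaleC_left)
next
  case KEKinv
  show ?case using assms(4) by simp
next
  case KFKinv
  show ?case using assms(5) by simp
next
  case K_fourth
  show ?case using assms(9) by (simp add: power4_eq_xxxx mult.assoc)
qed (simp_all add: assms(2-8) algebra_simps scaleC_add_left scaleC_add_right scaleC_scaleC
    mult_scaleC_left mult_scaleC_right scaleC_one)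

lemma pure_tensor_uminus: "(- a) \<otimes> b = - (a \<otimes> b)" "a \<otimes> (- b) = - (a \<otimes> b)"
  using pure_tensor_scaleC_left[of "-1" a b] pure_tensor_scaleC_right[of a "-1" b]
  by simp_all

lemma pure_tensor_diff:
  "(a - a') \<otimes> b = a \<otimes> b - a' \<otimes> b" "a \<otimes> (b - b') = a \<otimes> b - a \<otimes> b'"
  using pure_tensor_add_left[of a "- a'" b] pure_tensor_add_right[of a b "- b'"]
  by (simp_all add: pure_tensor_uminus)

lemma Q_commute:
  "K\<^sub>Q * E\<^sub>Q = - (E\<^sub>Q * K\<^sub>Q)" "K\<^sub>Q * F\<^sub>Q = - (F\<^sub>Q * K\<^sub>Q)" "Kinv\<^sub>Q * E\<^sub>Q = - (E\<^sub>Q * Kinv\<^sub>Q)"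
  "Kinv\<^sub>Q * F\<^sub>Q = - (F\<^sub>Q * Kinv\<^sub>Q)"
proof -
  have *: "K\<^sub>Q * x = - (x * K\<^sub>Q) \<and> Kinv\<^sub>Q * x = - (x * Kinv\<^sub>Q)" if "K\<^sub>Q * x * Kinv\<^sub>Q = - x" for x
  proof
    have "K\<^sub>Q * x = K\<^sub>Q * x * Kinv\<^sub>Q * K\<^sub>Q" by (simp add: mult.assoc Q_relations)
    then show 1: "K\<^sub>Q * x = - (x * K\<^sub>Q)" by (simp add: that)
    have "x * Kinv\<^sub>Q = Kinv\<^sub>Q * (K\<^sub>Q * x) * Kinv\<^sub>Q" by (simp add: Q_relations flip: mult.assoc)
    also have "\<dots> = - (Kinv\<^sub>Q * x)" by (simp add: 1 mult.assoc Q_relations)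
    finally show "Kinv\<^sub>Q * x = - (x * Kinv\<^sub>Q)" by simp
  qed
  show "K\<^sub>Q * E\<^sub>Q = - (E\<^sub>Q * K\<^sub>Q)" "K\<^sub>Q * F\<^sub>Q = - (F\<^sub>Q * K\<^sub>Q)" "Kinv\<^sub>Q * E\<^sub>Q = - (E\<^sub>Q * Kinv\<^sub>Q)"
    "Kinv\<^sub>Q * F\<^sub>Q = - (F\<^sub>Q * Kinv\<^sub>Q)"
    using *[OF Q_relations(3)] *[OF Q_relations(4)] by simp_all
qed

lemma coproduct_relations:
  fixes \<Delta>E \<Delta>F \<Delta>K \<Delta>Kinv :: "(Q, Q) tensor"
  defines "\<Delta>E \<equiv> 1 \<otimes> E\<^sub>Q + E\<^sub>Q \<otimes> K\<^sub>Q" and "\<Delta>F \<equiv> Kinv\<^sub>Q \<otimes> F\<^sub>Q + F\<^sub>Q \<otimes> 1"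
    and "\<Delta>K \<equiv> K\<^sub>Q \<otimes> K\<^sub>Q" and "\<Delta>Kinv \<equiv> Kinv\<^sub>Q \<otimes> Kinv\<^sub>Q"
  shows "\<Delta>K * \<Delta>Kinv = 1" "\<Delta>Kinv * \<Delta>K = 1"
    "\<Delta>K * \<Delta>E * \<Delta>Kinv = - \<Delta>E" "\<Delta>K * \<Delta>F * \<Delta>Kinv = - \<Delta>F"
    "\<Delta>E * \<Delta>F - \<Delta>F * \<Delta>E = (1 / (2 * \<i>)) *\<^sub>C (\<Delta>K - \<Delta>Kinv)"
    "\<Delta>E * \<Delta>E = 0" "\<Delta>F * \<Delta>F = 0" "\<Delta>K ^ 4 = 1"
proof -
  note defs = \<Delta>E_def \<Delta>F_def \<Delta>K_def \<Delta>Kinv_def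
  note distribs = distrib_left distrib_right pure_tensor_mult
  have "K\<^sub>Q * K\<^sub>Q * Kinv\<^sub>Q = K\<^sub>Q" by (simp add: mult.assoc Q_relations)
  then show "\<Delta>K * \<Delta>Kinv = 1" "\<Delta>Kinv * \<Delta>K = 1"
    "\<Delta>K * \<Delta>E * \<Delta>Kinv = - \<Delta>E" "\<Delta>K * \<Delta>F * \<Delta>Kinv = - \<Delta>F"
    by (simp_all add: defs distribs Q_relations pure_tensor_one pure_tensor_uminus)
  show "\<Delta>E * \<Delta>E = 0" "\<Delta>F * \<Delta>F = 0"
    by (simp_all add: defs distribs Q_relations Q_commute pure_tensor_uminus pure_tensor_zero)
  have pow: "(a \<otimes> b) ^ n = (a ^ n) \<otimes> (b ^ n)" for a b :: Q and n
    by (induction n) (simp_all add: pure_tensor_mult pure_tensor_one)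
  show "\<Delta>K ^ 4 = 1"
    by (simp add: defs pow Q_relations pure_tensor_one)
  have "\<Delta>E * \<Delta>F - \<Delta>F * \<Delta>E
      = Kinv\<^sub>Q \<otimes> (E\<^sub>Q * F\<^sub>Q - F\<^sub>Q * E\<^sub>Q) + (E\<^sub>Q * F\<^sub>Q - F\<^sub>Q * E\<^sub>Q) \<otimes> K\<^sub>Q"
    by (simp add: defs distribs Q_commute pure_tensor_uminus pure_tensor_diff)
  also have "\<dots> = (1 / (2 * \<i>)) *\<^sub>C (\<Delta>K - \<Delta>Kinv)"
    by (simp only: Q_relations pure_tensor_scaleC_left pure_tensor_scaleC_right
        pure_tensor_diff defs flip: scaleC_add_right) simp
  finally show "\<Delta>E * \<Delta>F - \<Delta>F * \<Delta>E = (1 / (2 * \<i>)) *\<^sub>C (\<Delta>K - \<Delta>Kinv)" .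
qed

(* The algebra homomorphism with the prescribed values on the generators. *)
lift_definition coproduct :: "Q \<Rightarrow> (Q, Q) tensor"
  is "Qeval (1 \<otimes> E\<^sub>Q + E\<^sub>Q \<otimes> K\<^sub>Q) (Kinv\<^sub>Q \<otimes> F\<^sub>Q + F\<^sub>Q \<otimes> 1) (K\<^sub>Q \<otimes> K\<^sub>Q) (Kinv\<^sub>Q \<otimes> Kinv\<^sub>Q)"
  by (erule Qeval_cong) (rule coproduct_relations)+

lemma coproduct_hom:
  "coproduct (x + y) = coproduct x + coproduct y"
  "coproduct (x * y) = coproduct x * coproduct y"
  "coproduct (c *\<^sub>C x) = c *\<^sub>C coproduct x"
  "coproduct 1 = 1"
proof -
  show "coproduct (x + y) = coproduct x + coproduct y" by transfer simp
  show "coproduct (x * y) = coproduct x * coproduct y" by transfer simp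
  show "coproduct (c *\<^sub>C x) = c *\<^sub>C coproduct x" by transfer (simp add: mult_scaleC_left)
  show "coproduct 1 = 1" by transfer (simp add: scaleC_one)
qed

lemma coproduct_generators:
  "coproduct E\<^sub>Q = 1 \<otimes> E\<^sub>Q + E\<^sub>Q \<otimes> K\<^sub>Q"
  "coproduct F\<^sub>Q = Kinv\<^sub>Q \<otimes> F\<^sub>Q + F\<^sub>Q \<otimes> 1"
  "coproduct K\<^sub>Q = K\<^sub>Q \<otimes> K\<^sub>Q"
proof -
  show "coproduct E\<^sub>Q = 1 \<otimes> E\<^sub>Q + E\<^sub>Q \<otimes> K\<^sub>Q" by transfer simp
  show "coproduct F\<^sub>Q = Kinv\<^sub>Q \<otimes> F\<^sub>Q + F\<^sub>Q \<otimes> 1" by transfer simp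
  show "coproduct K\<^sub>Q = K\<^sub>Q \<otimes> K\<^sub>Q" by transfer simp
qed

definition e0 :: Q where "e0 = (1/2) *\<^sub>C (1 + K\<^sub>Q ^ 2)"

definition e1 :: Q where "e1 = (1/2) *\<^sub>C (1 - K\<^sub>Q ^ 2)"

definition casimir :: Q where
  "casimir = F\<^sub>Q * E\<^sub>Q - (\<i>/4) *\<^sub>C (K\<^sub>Q - Kinv\<^sub>Q)"

definition R00 :: "(Q, Q) tensor" where
  "R00 = (1/2) *\<^sub>C (1 \<otimes> 1 + 1 \<otimes> K\<^sub>Q + K\<^sub>Q \<otimes> 1 - K\<^sub>Q \<otimes> K\<^sub>Q)
     * (1 \<otimes> 1 + (2 * \<i>) *\<^sub>C (E\<^sub>Q \<otimes> F\<^sub>Q))"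

definition R01 :: "(Q, Q) tensor" where
  "R01 = (1/2) *\<^sub>C (1 \<otimes> 1 - \<i> *\<^sub>C (1 \<otimes> K\<^sub>Q) + K\<^sub>Q \<otimes> 1 + \<i> *\<^sub>C (K\<^sub>Q \<otimes> K\<^sub>Q))
     * (1 \<otimes> 1 + (1 - \<i>) *\<^sub>C ((F\<^sub>Q * K\<^sub>Q) \<otimes> (E\<^sub>Q * K\<^sub>Q)) - (1 - \<i>) *\<^sub>C (E\<^sub>Q \<otimes> F\<^sub>Q)
        + (1 + \<i>) *\<^sub>C ((E\<^sub>Q * F\<^sub>Q * K\<^sub>Q) \<otimes> 1)
        + (2 * \<i>) *\<^sub>C ((E\<^sub>Q * F\<^sub>Q * K\<^sub>Q) \<otimes> (E\<^sub>Q * F\<^sub>Q * K\<^sub>Q)))"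

definition R10 :: "(Q, Q) tensor" where
  "R10 = (1/2) *\<^sub>C (1 \<otimes> 1 + 1 \<otimes> K\<^sub>Q - \<i> *\<^sub>C (K\<^sub>Q \<otimes> 1) + \<i> *\<^sub>C (K\<^sub>Q \<otimes> K\<^sub>Q))
     * (1 \<otimes> K\<^sub>Q + (1 - \<i>) *\<^sub>C ((F\<^sub>Q * K\<^sub>Q) \<otimes> E\<^sub>Q) + (1 - \<i>) *\<^sub>C (E\<^sub>Q \<otimes> (F\<^sub>Q * K\<^sub>Q))
        - (1 - \<i>) *\<^sub>C (1 \<otimes> (E\<^sub>Q * F\<^sub>Q))
        - (2 * \<i>) *\<^sub>C ((E\<^sub>Q * F\<^sub>Q * K\<^sub>Q) \<otimes> (E\<^sub>Q * F\<^sub>Q)))"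

definition R11 :: "complex \<Rightarrow> (Q, Q) tensor" where
  "R11 \<beta> = (\<beta>/2) *\<^sub>C (1 \<otimes> 1 - \<i> *\<^sub>C (1 \<otimes> K\<^sub>Q) - \<i> *\<^sub>C (K\<^sub>Q \<otimes> 1) + K\<^sub>Q \<otimes> K\<^sub>Q)
     * ((- \<i>) *\<^sub>C (K\<^sub>Q \<otimes> 1) + (2 * \<i>) *\<^sub>C ((E\<^sub>Q * K\<^sub>Q) \<otimes> F\<^sub>Q)
        + (1 - \<i>) *\<^sub>C (K\<^sub>Q \<otimes> (E\<^sub>Q * F\<^sub>Q * K\<^sub>Q)) - (1 + \<i>) *\<^sub>C ((E\<^sub>Q * F\<^sub>Q) \<otimes> 1)
        - (2 * \<i>) *\<^sub>C ((E\<^sub>Q * F\<^sub>Q) \<otimes> (E\<^sub>Q * F\<^sub>Q * K\<^sub>Q)))"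

definition Rmatrix :: "complex \<Rightarrow> (Q, Q) tensor" where
  "Rmatrix \<beta> = R00 * (e0 \<otimes> e0) + R01 * (e0 \<otimes> e1) + R10 * (e1 \<otimes> e0) + R11 \<beta> * (e1 \<otimes> e1)"

definition monodromy :: "complex \<Rightarrow> (Q, Q) tensor" where
  "monodromy \<beta> = tensor_flip (Rmatrix \<beta>) * Rmatrix \<beta>"

definition e1_plus :: Q where "e1_plus = ((1/2) *\<^sub>C 1 + casimir) * e1"

definition e1_minus :: Q where "e1_minus = ((1/2) *\<^sub>C 1 - casimir) * e1"

definition w_plus :: Q where "w_plus = (1/2) *\<^sub>C (E\<^sub>Q * F\<^sub>Q * (1 + K\<^sub>Q) * e0)"

definition w_minus :: Q where "w_minus = (1/2) *\<^sub>C (E\<^sub>Q * F\<^sub>Q * (1 - K\<^sub>Q) * e0)"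

definition ribbon :: "complex \<Rightarrow> Q" where
  "ribbon \<beta> = e0 + \<beta> *\<^sub>C (e1_plus - e1_minus) + (2 * \<i>) *\<^sub>C (w_plus - w_minus)"

definition cointegral :: "complex \<Rightarrow> Q" where
  "cointegral \<beta> = (\<beta>^2 / \<i>) *\<^sub>C (E\<^sub>Q * F\<^sub>Q * (\<Sum>j = 0..3. K\<^sub>Q ^ j))"

definition drinfeld_map :: "complex \<Rightarrow> Q dual \<Rightarrow> Q" where
  "drinfeld_map \<beta> f = tensor_contract f (monodromy \<beta>)"

definition radford_map :: "complex \<Rightarrow> Q dual \<Rightarrow> Q" where
  "radford_map \<beta> f = tensor_contract f (coproduct (cointegral \<beta>))"

definition modular_S :: "complex \<Rightarrow> Q \<Rightarrow> Q" where
  "modular_S \<beta> a = radford_map \<beta> (inv (drinfeld_map \<beta>) a)"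

definition bcoeff :: "complex \<Rightarrow> complex" where
  "bcoeff \<beta> = \<beta>^2 * exp (2 * complex_of_real pi * \<i> / 3)"

(* The inverse of S is taken on the centre, where S is to be a permutation. *)
definition modular_T :: "complex \<Rightarrow> Q \<Rightarrow> Q" where
  "modular_T \<beta> a = bcoeff \<beta> *\<^sub>C inv_into centre (modular_S \<beta>) (ribbon \<beta> * modular_S \<beta> a)"

definition SL2Z :: "(int^2^2) set" where
  "SL2Z = {A. det A = 1}"

definition S_mat :: "int^2^2" where
  "S_mat = vector [vector [0, -1], vector [1, 0]]"

definition T_mat :: "int^2^2" where
  "T_mat = vector [vector [1, 1], vector [0, 1]]"

definition linear_between ::
    "(complex \<Rightarrow> 'v \<Rightarrow> 'v) \<Rightarrow> 'v set \<Rightarrow> (complex \<Rightarrow> 'w \<Rightarrow> 'w) \<Rightarrow> 'w set \<Rightarrow>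
      ('v::ab_group_add \<Rightarrow> 'w::ab_group_add) \<Rightarrow> bool" where
  "linear_between sv V sw W f \<longleftrightarrow>
     (\<forall>v\<in>V. f v \<in> W) \<and> (\<forall>u\<in>V. \<forall>v\<in>V. f (u + v) = f u + f v) \<and> (\<forall>c. \<forall>v\<in>V. f (sv c v) = sw c (f v))"

(* act is a linear SL(2,Z)-action on the subspace V of the complex vector space with scaling sv;
   act g is only relevant for g in SL2Z and on V. *)
definition SL2Z_rep ::
    "(complex \<Rightarrow> 'v \<Rightarrow> 'v) \<Rightarrow> 'v set \<Rightarrow> (int^2^2 \<Rightarrow> 'v::ab_group_add \<Rightarrow> 'v) \<Rightarrow> bool" where
  "SL2Z_rep sv V act \<longleftrightarrow>
     vector_space sv \<and> module.subspace sv V \<and>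
     (\<forall>g\<in>SL2Z. linear_between sv V sv V (act g)) \<and>
     (\<forall>v\<in>V. act (mat 1) v = v) \<and>
     (\<forall>g\<in>SL2Z. \<forall>h\<in>SL2Z. \<forall>v\<in>V. act (g ** h) v = act g (act h v))"

definition SL2Z_rep_equiv ::
    "(complex \<Rightarrow> 'v \<Rightarrow> 'v) \<Rightarrow> 'v set \<Rightarrow> (int^2^2 \<Rightarrow> 'v::ab_group_add \<Rightarrow> 'v) \<Rightarrow>
      (complex \<Rightarrow> 'w \<Rightarrow> 'w) \<Rightarrow> 'w set \<Rightarrow> (int^2^2 \<Rightarrow> 'w::ab_group_add \<Rightarrow> 'w) \<Rightarrow> bool" where
  "SL2Z_rep_equiv sv V act sw W act' \<longleftrightarrow>
     (\<exists>f. linear_between sv V sw W f \<and> bij_betw f V W \<and>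
       (\<forall>g\<in>SL2Z. \<forall>v\<in>V. f (act g v) = act' g (f v)))"

definition basis_of :: "(complex \<Rightarrow> 'v \<Rightarrow> 'v) \<Rightarrow> 'v set \<Rightarrow> 'v::ab_group_add list \<Rightarrow> bool" where
  "basis_of sv V bs \<longleftrightarrow>
     distinct bs \<and> \<not> module.dependent sv (set bs) \<and> module.span sv (set bs) = V"

definition direct_sum_of :: "'v set \<Rightarrow> 'v set \<Rightarrow> 'v::ab_group_add set \<Rightarrow> bool" where
  "direct_sum_of V W U \<longleftrightarrow> V \<inter> W = {0} \<and> {v + w | v w. v \<in> V \<and> w \<in> W} = U"

(* The representation of Feigin, Gainutdinov, Semikhatov and Tipunin at p = 2. *)
datatype fgst_index = Rho1 | Phi1 | Kappa0 | Kappa1 | Kappa2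

instance fgst_index :: finite
proof
  have "x \<in> {Rho1, Phi1, Kappa0, Kappa1, Kappa2}" for x by (cases x) auto
  then show "finite (UNIV :: fgst_index set)" by (meson finite.simps finite_subset subsetI)
qed

type_synonym fgst = "complex^fgst_index"

abbreviation fgst_basis :: "fgst_index \<Rightarrow> fgst" where
  "fgst_basis i \<equiv> axis i 1"

fun fgst_S_basis :: "fgst_index \<Rightarrow> fgst" where
  "fgst_S_basis Rho1 = (- \<i>) *s fgst_basis Phi1"
| "fgst_S_basis Phi1 = \<i> *s fgst_basis Rho1"
| "fgst_S_basis Kappa0 = (1/2) *s (fgst_basis Kappa0 - 2 *s fgst_basis Kappa1 + fgst_basis Kappa2)"
| "fgst_S_basis Kappa1 = (1/2) *s (fgst_basis Kappa2 - fgst_basis Kappa0)"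
| "fgst_S_basis Kappa2 = (1/2) *s (fgst_basis Kappa0 + 2 *s fgst_basis Kappa1 + fgst_basis Kappa2)"

fun fgst_T_basis :: "fgst_index \<Rightarrow> fgst" where
  "fgst_T_basis Rho1 = exp (\<i> * of_real pi / 6) *s fgst_basis Rho1"
| "fgst_T_basis Phi1 = exp (\<i> * of_real pi / 6) *s (fgst_basis Phi1 + fgst_basis Rho1)"
| "fgst_T_basis Kappa0 = (- exp (- \<i> * of_real pi / 12)) *s fgst_basis Kappa0"
| "fgst_T_basis Kappa1 = exp (\<i> * of_real pi / 6) *s fgst_basis Kappa1"
| "fgst_T_basis Kappa2 = exp (- \<i> * of_real pi / 12) *s fgst_basis Kappa2"

definition fgst_rep :: "(int^2^2 \<Rightarrow> fgst \<Rightarrow> fgst) \<Rightarrow> bool" where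
  "fgst_rep act \<longleftrightarrow> SL2Z_rep (*s) UNIV act \<and>
     (\<forall>i. act S_mat (fgst_basis i) = fgst_S_basis i \<and> act T_mat (fgst_basis i) = fgst_T_basis i)"

end

theory Submission
  imports Defs
begin

text \<open>
  The words \<open>E\<^sup>a F\<^sup>b\<close> times an eigenprojection of \<open>K\<close> form a basis of \<open>Q\<close>, and both the monodromy
  matrix and \<open>\<Delta>(\<^bold>c)\<close> are sparse in the induced basis of \<open>Q \<otimes> Q\<close>: the former splits into small
  blocks that are inverted by hand, the latter is a permutation matrix up to scalars. This gives
  \<open>\<S>\<close> in coordinates. On the centre, \<open>\<S>\<close> is an involution, so \<open>\<T>\<close> is \<open>b\<close> times the conjugate by
  \<open>\<S>\<close> of multiplication by the ribbon element, and \<open>\<T>\<close> is diagonalised (up to one Jordan block) by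
  the \<open>\<S>\<close>-images of the elements \<open>e\<^sub>0\<close>, \<open>w\<^sup>+ - w\<^sup>-\<close>, \<open>e\<^sub>1\<^sup>+\<close>, \<open>e\<^sub>1\<^sup>-\<close>, \<open>w\<^sup>+ + w\<^sup>-\<close>.
  An action of \<open>SL(2, \<int>)\<close> results because \<open>PSL(2, \<int>)\<close> is presented by \<open>S\<^sup>2 = (S T)\<^sup>3 = 1\<close>.
\<close>

section \<open>Actions of the modular group from generators\<close>

text \<open>Two things shape the proof. First, \<open>Q\<close> and its tensor square are quotients
  of formal expressions, so independence of the words has to be exhibited: for each eigenvalue
  \<open>w\<close> of \<open>K\<close> an explicit four-dimensional module is checked against the
  defining relations, and the coordinates of an element are read off from its action there.
  Equations between linear combinations are tested by linear functionals, which turns them into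
  complex arithmetic. Second, an action needs an operator for every matrix. Each matrix gets the
  word of its continued fraction; the real content is multiplicativity, where left multiplication by
  S is the hard case. The construction asks for identities of functions on a whole type, whereas on
  \<open>Q\<close> the operators are controlled only on the centre. So the action is built on the
  coordinate vectors \<open>fgst\<close> and transported along \<open>central_iso\<close>. There S
  does not involve \<beta>, and at \<beta> = exp(-i pi/4) the coordinate action is already the FGST
  representation.\<close>

definition int_iter :: "('v \<Rightarrow> 'v) \<Rightarrow> ('v \<Rightarrow> 'v) \<Rightarrow> int \<Rightarrow> 'v \<Rightarrow> 'v" where
  "int_iter t t' n = (if 0 \<le> n then t ^^ nat n else t' ^^ nat (- n))"

lemma int_iter_0 [simp]: "int_iter t t' 0 = id"
  by (simp add: int_iter_def)

lemma int_iter_1 [simp]: "int_iter t t' 1 = t"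
  by (simp add: int_iter_def)

text \<open>\<open>t'\<close> stands for the inverse of \<open>t\<close>. For negative
  \<open>n\<close> the new \<open>t\<close> cancels the outermost \<open>t'\<close>.\<close>

lemma int_iter_Suc:
  assumes "t \<circ> t' = id"
  shows "int_iter t t' (n + 1) = t \<circ> int_iter t t' n"
proof (cases "0 \<le> n")
  case True
  then have "nat (n + 1) = Suc (nat n)" by simp
  with True show ?thesis by (simp add: int_iter_def)
next
  case False
  then have "nat (- n) = Suc (nat (- (n + 1)))" by simp
  with False have "t \<circ> int_iter t t' n = (t \<circ> t') \<circ> t' ^^ nat (- (n + 1))"
    by (simp only: int_iter_def if_False funpow.simps comp_assoc)
  with False assms show ?thesis by (auto simp: int_iter_def)
qed

context
  fixes s t t' :: "'v \<Rightarrow> 'v"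
begin

text \<open>The Euclidean algorithm on the first column: for \<open>c \<noteq> 0\<close> the matrix \<open>((a, b), (c, d))\<close> is
  \<open>T ^ (a div c) * S\<close>, up to sign, times a matrix whose lower left entry \<open>- (a mod c)\<close> is smaller.
  Signs are immaterial, since \<open>s \<circ> s = id\<close> is going to be assumed.\<close>

function cfrac_word :: "int \<Rightarrow> int \<Rightarrow> int \<Rightarrow> int \<Rightarrow> 'v \<Rightarrow> 'v" where
  "cfrac_word a b c d =
    (if c = 0 then int_iter t t' (a * b)
     else int_iter t t' (a div c) \<circ> s \<circ>
       cfrac_word c d (- (a mod c)) (- (b - (a div c) * d)))"
  by pat_completeness auto
termination
  by (relation "Wellfounded.measure (\<lambda>(_, _, c, _). nat \<bar>c\<bar>)") (auto simp: abs_mod_less)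

declare cfrac_word.simps [simp del]

text \<open>This is the descent to PSL(2, Z): negating both \<open>a\<close> and \<open>c\<close>
  keeps the quotient and negates the remainder, so the two recursions run in parallel.\<close>

lemma cfrac_word_uminus: "cfrac_word (- a) (- b) (- c) (- d) = cfrac_word a b c d"
proof (induction a b c d rule: cfrac_word.induct)
  case (1 a b c d)
  show ?case
  proof (cases "c = 0")
    case False
    have "- (- b - (a div c) * (- d)) = - (- (b - (a div c) * d))" by simp
    moreover have "- (- a mod - c) = - (- (a mod c))" by (simp add: mod_minus_minus)
    ultimately show ?thesis
      using 1[OF False] False
      by (subst (1 2) cfrac_word.simps) simp
  qed (subst (1 2) cfrac_word.simps, simp)
qed

context
  assumes ss: "s \<circ> s = id" and tt': "t \<circ> t' = id" and t't: "t' \<circ> t = id"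
    and st3: "s \<circ> t \<circ> s \<circ> t \<circ> s \<circ> t = id"
begin

text \<open>This relation and the next are (s t)^3 = 1 and its inverse, rearranged so as to remove a
  \<open>t\<close> or \<open>t'\<close> enclosed by two letters \<open>s\<close>. In
  \<open>cfrac_word_S\<close> they resolve the quotients 1 and -1.\<close>

lemma braid: "s \<circ> t \<circ> s = t' \<circ> s \<circ> t'"
proof -
  have "s \<circ> t \<circ> s = s \<circ> t \<circ> s \<circ> t \<circ> (s \<circ> s) \<circ> t'" by (simp add: ss tt' comp_assoc)
  also have "\<dots> = s \<circ> t \<circ> s \<circ> t \<circ> s \<circ> (t \<circ> t') \<circ> s \<circ> t'" by (simp add: tt' comp_assoc)
  also have "\<dots> = (s \<circ> t \<circ> s \<circ> t \<circ> s \<circ> t) \<circ> t' \<circ> s \<circ> t'" by (simp only: comp_assoc)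
  finally show ?thesis by (simp only: st3 id_comp)
qed

lemma braid': "s \<circ> t' \<circ> s = t \<circ> s \<circ> t"
proof -
  have "t \<circ> s \<circ> t = (s \<circ> t' \<circ> (t \<circ> s)) \<circ> (t \<circ> s \<circ> t)"
    using ss tt' t't by (metis (no_types, lifting) comp_assoc comp_id id_comp)
  also have "\<dots> = s \<circ> t' \<circ> (s \<circ> s) \<circ> t \<circ> s \<circ> t \<circ> s \<circ> t" by (simp add: ss comp_assoc)
  also have "\<dots> = s \<circ> t' \<circ> s \<circ> (s \<circ> t \<circ> s \<circ> t \<circ> s \<circ> t)" by (simp add: comp_assoc)
  finally show ?thesis by (simp only: st3 comp_id)
qed

text \<open>Adding the second row to the first raises the first quotient by one and keeps the
  remainder. If c = 0, the determinant gives a*d = 1, so the exponent a*b grows by one.\<close>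

lemma cfrac_word_T:
  assumes "a * d - b * c = 1"
  shows "cfrac_word (a + c) (b + d) c d = t \<circ> cfrac_word a b c d"
proof (cases "c = 0")
  case True
  with assms have "(a + c) * (b + d) = a * b + 1" by (simp add: algebra_simps)
  with True show ?thesis
    by (subst (1 2) cfrac_word.simps) (simp add: int_iter_Suc tt')
next
  case False
  have "(a + c) div c = a div c + 1" using False by (simp add: div_add_self2)
  moreover have "- (b + d - (a div c + 1) * d) = - (b - a div c * d)" by (simp add: algebra_simps)
  ultimately show ?thesis using False
    by (subst (1 2) cfrac_word.simps)
      (simp only: int_iter_Suc[OF tt'] comp_assoc if_False mod_add_self2)
qed

lemma cfrac_word_T':
  assumes "a * d - b * c = 1"
  shows "cfrac_word (a - c) (b - d) c d = t' \<circ> cfrac_word a b c d"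
proof -
  have "cfrac_word a b c d = t \<circ> cfrac_word (a - c) (b - d) c d"
    using cfrac_word_T[of "a - c" d "b - d" c] assms by (simp add: algebra_simps)
  then have "t' \<circ> cfrac_word a b c d = (t' \<circ> t) \<circ> cfrac_word (a - c) (b - d) c d"
    by (simp add: comp_assoc)
  then show ?thesis by (simp add: t't)
qed

text \<open>The first quotient is 0, so the recursion emits a bare \<open>s\<close>; the sign of the
  remaining matrix is absorbed by \<open>cfrac_word_uminus\<close>.\<close>

lemma cfrac_word_reduced:
  assumes "0 \<le> a" "a < c"
  shows "cfrac_word a b c d = s \<circ> cfrac_word (- c) (- d) a b"
  using assms cfrac_word_uminus[of c d "- a" "- b"]
  by (subst cfrac_word.simps) simp

text \<open>The crux of multiplicativity: the Euclidean algorithm for the S-image need not start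
  with a bare \<open>s\<close>. As \<open>s\<close> is an involution, the claims for a matrix and
  for its S-image are equivalent, so |a| <= |c| may be assumed, and c > 0 by the sign rule. If the
  first quotient is 0 the claim is \<open>cfrac_word_reduced\<close>. Otherwise a = c or a < 0, the
  quotient is 1 or -1, and a braid relation reduces the claim to one with smaller |a| + |c|.\<close>

lemma cfrac_word_S:
  assumes "a * d - b * c = 1"
  shows "cfrac_word (- c) (- d) a b = s \<circ> cfrac_word a b c d"
  using assms
proof (induction "nat (\<bar>a\<bar> + \<bar>c\<bar>)" arbitrary: a b c d rule: less_induct)
  case less
  note IH = less.hyps and det = less.prems
  have swap: "u = s \<circ> v" if "v = s \<circ> u" for u v :: "'v \<Rightarrow> 'v"
    using that ss by (metis comp_assoc id_comp)
  \<comment> \<open>\<open>N\<close> and \<open>IH\<close> are parameters because this case is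
    reused for the negated matrix and, through \<open>main\<close>, for the matrix with its rows
    exchanged.\<close>
  have pos: "cfrac_word (- c) (- d) a b = s \<circ> cfrac_word a b c d"
    if le: "\<bar>a\<bar> \<le> c" and det: "a * d - b * c = 1" and n: "nat (\<bar>a\<bar> + \<bar>c\<bar>) \<le> N"
      and IH: "\<And>a b c d. nat (\<bar>a\<bar> + \<bar>c\<bar>) < N \<Longrightarrow> a * d - b * c = 1 \<Longrightarrow>
        cfrac_word (- c) (- d) a b = s \<circ> cfrac_word a b c d" for a b c d N
  proof -
    have c: "c > 0" using le det by (cases "c = 0") auto
    consider "0 \<le> a" "a < c" | "a = c" | "a < 0" using le by linarith
    then show ?thesis
    proof cases
      case 1
      show ?thesis by (rule swap, rule cfrac_word_reduced[OF 1])
    next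
      case 2
      \<comment> \<open>The determinant is c*(d - b) = 1 here, which supplies the determinant
        conditions of all the matrices below.\<close>
      have "cfrac_word a b c d = t \<circ> cfrac_word 0 (b - d) c d"
        using cfrac_word_T[of 0 d "b - d" c] det 2 by (simp add: algebra_simps)
      also have "cfrac_word 0 (b - d) c d = s \<circ> cfrac_word (- c) (- d) 0 (b - d)"
        using c by (intro cfrac_word_reduced) auto
      finally have "s \<circ> cfrac_word a b c d = (s \<circ> t \<circ> s) \<circ> cfrac_word (- c) (- d) 0 (b - d)"
        by (simp only: comp_assoc)
      also have "\<dots> = t' \<circ> (s \<circ> (t' \<circ> cfrac_word (- c) (- d) 0 (b - d)))"
        by (subst braid) (simp only: comp_assoc)
      also have "t' \<circ> cfrac_word (- c) (- d) 0 (b - d) = cfrac_word (- c) (- b) 0 (b - d)"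
        using cfrac_word_T'[of "- c" "b - d" "- d" 0] det 2 by (simp add: algebra_simps)
      \<comment> \<open>The size has dropped from 2*c to c.\<close>
      also have "s \<circ> \<dots> = cfrac_word 0 (- (b - d)) (- c) (- b)"
        using IH[of "- c" 0 "b - d" "- b"] det 2 n c by (simp add: algebra_simps)
      also have "t' \<circ> \<dots> = cfrac_word c d (- c) (- b)"
        using cfrac_word_T'[of 0 "- b" "- (b - d)" "- c"] det 2 by (simp add: algebra_simps)
      also have "\<dots> = cfrac_word (- c) (- d) a b"
        using cfrac_word_uminus[of "-c" "-d" c b] 2 by simp
      finally show ?thesis ..
    next
      case 3
      have "cfrac_word a b c d = t' \<circ> cfrac_word (a + c) (b + d) c d"
        using cfrac_word_T'[of "a + c" d "b + d" c] det by (simp add: algebra_simps)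
      also have "cfrac_word (a + c) (b + d) c d = s \<circ> cfrac_word (- c) (- d) (a + c) (b + d)"
        using c le 3 by (intro cfrac_word_reduced) auto
      finally have "s \<circ> cfrac_word a b c d = (s \<circ> t' \<circ> s) \<circ> cfrac_word (- c) (- d) (a + c) (b + d)"
        by (simp only: comp_assoc)
      also have "\<dots> = t \<circ> (s \<circ> (t \<circ> cfrac_word (- c) (- d) (a + c) (b + d)))"
        by (subst braid') (simp only: comp_assoc)
      also have "t \<circ> cfrac_word (- c) (- d) (a + c) (b + d) = cfrac_word a b (a + c) (b + d)"
        using cfrac_word_T[of "- c" "b + d" "- d" "a + c"] det by (simp add: algebra_simps)
      \<comment> \<open>Since -c <= a < 0, the size |a| + |a + c| equals c, which is less than |a| +
        c.\<close>
      also have "s \<circ> \<dots> = cfrac_word (- (a + c)) (- (b + d)) a b"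
        using det n c le 3 by (intro IH[symmetric]) (auto simp: algebra_simps)
      also have "t \<circ> \<dots> = cfrac_word (- c) (- d) a b"
        using cfrac_word_T[of "- (a + c)" b "- (b + d)" a] det by (simp add: algebra_simps)
      finally show ?thesis ..
    qed
  qed
  have main: "cfrac_word (- c) (- d) a b = s \<circ> cfrac_word a b c d"
    if "\<bar>a\<bar> \<le> \<bar>c\<bar>" "a * d - b * c = 1" "nat (\<bar>a\<bar> + \<bar>c\<bar>) \<le> N"
      and IH: "\<And>a b c d. nat (\<bar>a\<bar> + \<bar>c\<bar>) < N \<Longrightarrow> a * d - b * c = 1 \<Longrightarrow>
        cfrac_word (- c) (- d) a b = s \<circ> cfrac_word a b c d" for a b c d N
    using pos[of a c d b N] pos[of "- a" "- c" "- d" "- b" N] that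
      cfrac_word_uminus[of a b c d] cfrac_word_uminus[of "-c" "-d" a b]
    by (cases "c \<ge> 0") auto
  show ?case
  proof (cases "\<bar>a\<bar> \<le> \<bar>c\<bar>")
    case True
    then show ?thesis using main[OF True det order.refl IH] by simp
  next
    case False
    have "cfrac_word (- a) (- b) (- c) (- d) = s \<circ> cfrac_word (- c) (- d) a b"
      by (rule main[OF _ _ order.refl]) (use False det IH in \<open>auto simp: algebra_simps\<close>)
    then have "cfrac_word a b c d = s \<circ> cfrac_word (- c) (- d) a b"
      by (simp only: cfrac_word_uminus)
    then show ?thesis by (rule swap)
  qed
qed

lemma cfrac_word_T_power:
  assumes "a * d - b * c = 1"
  shows "cfrac_word (a + n * c) (b + n * d) c d = int_iter t t' n \<circ> cfrac_word a b c d"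
proof (induction n rule: int_induct[where k = 0])
  case (step1 n)
  have "cfrac_word (a + (n + 1) * c) (b + (n + 1) * d) c d
    = t \<circ> cfrac_word (a + n * c) (b + n * d) c d"
    using cfrac_word_T[of "a + n * c" d "b + n * d" c] assms by (simp add: algebra_simps)
  then show ?case by (simp only: step1.IH int_iter_Suc[OF tt'] comp_assoc)
next
  case (step2 n)
  have "int_iter t t' n = t \<circ> int_iter t t' (n - 1)"
    using int_iter_Suc[OF tt', of "n - 1"] by simp
  then have "int_iter t t' (n - 1) = t' \<circ> int_iter t t' n"
    using t't by (metis comp_assoc id_comp)
  moreover have "cfrac_word (a + (n - 1) * c) (b + (n - 1) * d) c d
    = t' \<circ> cfrac_word (a + n * c) (b + n * d) c d"
    using cfrac_word_T'[of "a + n * c" d "b + n * d" c] assms by (simp add: algebra_simps)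
  ultimately show ?case by (simp only: step2.IH comp_assoc)
qed simp

text \<open>Induction along the word of the left factor: its letters are moved onto the product one
  at a time, powers of \<open>t\<close> by \<open>cfrac_word_T_power\<close> and each
  \<open>s\<close> by \<open>cfrac_word_S\<close>.\<close>

lemma cfrac_word_mult:
  assumes "a * d - b * c = 1" "a' * d' - b' * c' = 1"
  shows "cfrac_word (a * a' + b * c') (a * b' + b * d') (c * a' + d * c') (c * b' + d * d')
    = cfrac_word a b c d \<circ> cfrac_word a' b' c' d'"
  using assms(1)
proof (induction a b c d rule: cfrac_word.induct)
  case (1 a b c d)
  show ?case
  proof (cases "c = 0")
    case True
    with 1(2) have "a * d = 1" by simp
    \<comment> \<open>The left factor is T^(a*b) up to sign, which explains the exponent in the base
      case of \<open>cfrac_word\<close>.\<close>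
    then have "a = 1 \<and> d = 1 \<or> a = - 1 \<and> d = - 1" by (simp add: zmult_eq_1_iff)
    then show ?thesis
      using True cfrac_word_T_power[OF assms(2), of "a * b"]
        cfrac_word_uminus[of "a' + a * b * c'" "b' + a * b * d'" c' d']
      by (subst (2) cfrac_word.simps) (auto simp: algebra_simps)
  next
    case False
    define q where "q = a div c"
    have a: "a mod c = a - q * c" by (simp add: q_def minus_div_mult_eq_mod)
    let ?A = "c * a' + d * c'" and ?B = "c * b' + d * d'"
    let ?C = "- (a mod c) * a' + - (b - q * d) * c'" and ?D = "- (a mod c) * b' + - (b - q * d) * d'"
    have det': "c * - (b - q * d) - d * - (a mod c) = 1"
      using 1(2) by (simp add: a algebra_simps)
    have "?A * ?D - ?B * ?C = (c * - (b - q * d) - d * - (a mod c)) * (a' * d' - b' * c')"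
      by (simp add: algebra_simps)
    then have det2: "?A * ?D - ?B * ?C = 1" using det' assms(2) by simp
    have IH: "cfrac_word ?A ?B ?C ?D
      = cfrac_word c d (- (a mod c)) (- (b - q * d)) \<circ> cfrac_word a' b' c' d'"
      using 1(1)[OF False] det' unfolding q_def by blast
    have "cfrac_word (a * a' + b * c') (a * b' + b * d') ?A ?B
      = cfrac_word (- ?C + q * ?A) (- ?D + q * ?B) ?A ?B"
      by (simp add: a algebra_simps)
    also have "\<dots> = int_iter t t' q \<circ> (cfrac_word (- ?C) (- ?D) ?A ?B)"
      using det2 by (intro cfrac_word_T_power) (simp add: algebra_simps)
    also have "cfrac_word (- ?C) (- ?D) ?A ?B = s \<circ> cfrac_word ?A ?B ?C ?D"
      using det2 by (intro cfrac_word_S)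
    finally show ?thesis
      using False
      by (subst cfrac_word.simps[of a b c d]) (simp only: IH flip: q_def, simp only: comp_assoc if_False)
  qed
qed

text \<open>Carries properties of the letters over to every group element; it will supply linearity
  and the invariance of subspaces. \<open>t'\<close> is among the letters because quotients can be
  negative.\<close>

lemma cfrac_word_closed:
  assumes "P id" "\<And>f. P f \<Longrightarrow> P (s \<circ> f)" "\<And>f. P f \<Longrightarrow> P (t \<circ> f)" "\<And>f. P f \<Longrightarrow> P (t' \<circ> f)"
  shows "P (cfrac_word a b c d)"
proof (induction a b c d rule: cfrac_word.induct)
  case (1 a b c d)
  have *: "P (int_iter t t' n \<circ> f)" if "P f" for n f
  proof -
    have "P (t ^^ m \<circ> f)" "P (t' ^^ m \<circ> f)" for m
      using assms that by (induction m) (auto simp: comp_assoc)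
    then show ?thesis by (simp add: int_iter_def)
  qed
  show ?case
    using *[OF assms(1), of "a * b"] *[OF assms(2)[OF 1]]
    by (subst cfrac_word.simps) (simp add: comp_assoc)
qed

lemma exists_PSL2Z_action:
  obtains act :: "int^2^2 \<Rightarrow> 'v \<Rightarrow> 'v" where
    "act (mat 1) = id" "act S_mat = s" "act T_mat = t"
    "\<And>g h. g \<in> SL2Z \<Longrightarrow> h \<in> SL2Z \<Longrightarrow> act (g ** h) = act g \<circ> act h"
    "\<And>P g. P id \<Longrightarrow> (\<And>f. P f \<Longrightarrow> P (s \<circ> f)) \<Longrightarrow> (\<And>f. P f \<Longrightarrow> P (t \<circ> f)) \<Longrightarrow>
      (\<And>f. P f \<Longrightarrow> P (t' \<circ> f)) \<Longrightarrow> P (act g)"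
proof
  let ?act = "\<lambda>g :: int^2^2. cfrac_word (g $ 1 $ 1) (g $ 1 $ 2) (g $ 2 $ 1) (g $ 2 $ 2)"
  show "?act (mat 1) = id" "?act T_mat = t"
    by (simp_all add: mat_def T_mat_def cfrac_word.simps[of _ _ 0])
  show "?act S_mat = s"
    by (simp add: S_mat_def cfrac_word.simps[of 0] cfrac_word.simps[of _ _ 0])
  show "?act (g ** h) = ?act g \<circ> ?act h" if "g \<in> SL2Z" "h \<in> SL2Z" for g h
    using that cfrac_word_mult[of "g $ 1 $ 1" "g $ 2 $ 2" "g $ 1 $ 2" "g $ 2 $ 1"
        "h $ 1 $ 1" "h $ 2 $ 2" "h $ 1 $ 2" "h $ 2 $ 1"]
    by (simp add: SL2Z_def det_2 matrix_matrix_mult_def sum_2)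
  show "P (?act g)" if "P id" "\<And>f. P f \<Longrightarrow> P (s \<circ> f)" "\<And>f. P f \<Longrightarrow> P (t \<circ> f)"
    "\<And>f. P f \<Longrightarrow> P (t' \<circ> f)" for P g
    using that by (rule cfrac_word_closed)
qed

end
end

section \<open>A basis of the quantum group\<close>

abbreviation functional :: "('a::complex_algebra \<Rightarrow> complex) \<Rightarrow> bool" where
  "functional \<equiv> Vector_Spaces.linear scaleC (*)"

lemma vector_space_complex: "vector_space ((*) :: complex \<Rightarrow> complex \<Rightarrow> complex)"
  by standard (simp_all add: algebra_simps)

text \<open>If x - y is nonzero, the functional with value 1 on it extends from its span. Applying
  an arbitrary functional to both sides lets field arithmetic collect the terms of an identity in
  \<open>Q\<close> or in a tensor product.\<close>

lemma functionals_separate: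
  fixes x y :: "'a::complex_algebra"
  assumes "\<And>g. functional g \<Longrightarrow> g x = g y"
  shows "x = y"
proof (rule ccontr)
  assume "x \<noteq> y"
  interpret vector_space_pair "scaleC :: complex \<Rightarrow> 'a \<Rightarrow> 'a" "(*) :: complex \<Rightarrow> complex \<Rightarrow> complex"
    by (intro vector_space_pair.intro cvs.vector_space_axioms vector_space_complex)
  have "cvs.independent {x - y}" using \<open>x \<noteq> y\<close> by simp
  then obtain g where g: "functional g" "g (x - y) = 1"
    using linear_independent_extend[of "{x - y}" "\<lambda>_. 1"] by auto
  interpret g: Vector_Spaces.linear scaleC "(*)" g by (rule g)
  show False using assms[OF g(1)] g(2) by (simp add: g.diff)
qed

lemma functionalI:
  fixes g :: "'a::complex_algebra \<Rightarrow> complex"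
  assumes "\<And>x y. g (x + y) = g x + g y" "\<And>c x. g (c *\<^sub>C x) = c * g x"
  shows "functional g"
proof -
  have "module ((*) :: complex \<Rightarrow> complex \<Rightarrow> complex)"
    using vector_space_complex by (simp add: module_iff_vector_space)
  then show ?thesis
    by (intro Vector_Spaces.linear.intro cvs.vector_space_axioms vector_space_complex
        module_hom.intro cvs.module_axioms module_hom_axioms.intro assms)
qed

lemma functional_simps:
  assumes "functional g"
  shows "g (x + y) = g x + g y" "g (x - y) = g x - g y" "g (- x) = - g x" "g (c *\<^sub>C x) = c * g x"
    "g 0 = 0" "g (sum h A) = (\<Sum>a\<in>A. g (h a))"
proof -
  interpret g: Vector_Spaces.linear scaleC "(*)" g by (rule assms)
  show "g (x + y) = g x + g y" "g (x - y) = g x - g y" "g (- x) = - g x" "g (c *\<^sub>C x) = c * g x"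
    "g 0 = 0" "g (sum h A) = (\<Sum>a\<in>A. g (h a))"
    by (simp_all add: g.add g.diff g.neg g.scale g.zero g.sum)
qed

lemma Q_induct [case_names scal E F K Kinv add mult]:
  assumes "\<And>c. P (c *\<^sub>C 1)" "P E\<^sub>Q" "P F\<^sub>Q" "P K\<^sub>Q" "P Kinv\<^sub>Q"
    and "\<And>x y. P x \<Longrightarrow> P y \<Longrightarrow> P (x + y)" "\<And>x y. P x \<Longrightarrow> P y \<Longrightarrow> P (x * y)"
  shows "P (x :: Q)"
proof -
  have scal: "abs_Q (Scal c) = c *\<^sub>C 1" for c
    by (simp add: scaleC_Q.abs_eq one_Q.abs_eq Q.abs_eq_iff)
      (metis Qrel.Scal_Mul mult.right_neutral)
  have "P (abs_Q t)" for t
    using assms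
    by (induction t) (simp_all add: scal flip: E\<^sub>Q.abs_eq F\<^sub>Q.abs_eq K\<^sub>Q.abs_eq Kinv\<^sub>Q.abs_eq
        plus_Q.abs_eq times_Q.abs_eq)
  then show ?thesis by (metis Quotient_Q Quotient_def)
qed

section \<open>Eigenprojections of K and straightening of words\<close>

lemma Kinv_eq: "Kinv\<^sub>Q = K\<^sub>Q ^ 3"
proof -
  have "Kinv\<^sub>Q = Kinv\<^sub>Q * K\<^sub>Q ^ 4" by (simp add: Q_relations)
  also have "\<dots> = (Kinv\<^sub>Q * K\<^sub>Q) * K\<^sub>Q ^ 3" by (simp only: mult.assoc flip: power_Suc) simp
  finally show ?thesis by (simp add: Q_relations)
qed

text \<open>The spectral projection of K for the eigenvalue \<open>w\<close>, a discrete Fourier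
  transform of the powers of K. For a fourth root of unity \<open>w ^ 3\<close> is the inverse of
  \<open>w\<close>.\<close>

definition K_idem :: "complex \<Rightarrow> Q" where
  "K_idem w = (1/4) *\<^sub>C (1 + w ^ 3 *\<^sub>C K\<^sub>Q + w ^ 2 *\<^sub>C K\<^sub>Q ^ 2 + w *\<^sub>C K\<^sub>Q ^ 3)"

definition fourth_roots :: "complex set" where
  "fourth_roots = {1, \<i>, - 1, - \<i>}"

lemma fourth_roots_distinct:
  "\<i> \<noteq> 1" "1 \<noteq> \<i>" "\<i> \<noteq> - 1" "- 1 \<noteq> \<i>" "- \<i> \<noteq> 1" "1 \<noteq> - \<i>" "\<i> \<noteq> - \<i>" "- \<i> \<noteq> \<i>"
  by (simp_all add: complex_eq_iff)

lemma fourth_roots_power: "w \<in> fourth_roots \<Longrightarrow> w ^ 4 = 1"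
  by (auto simp: fourth_roots_def power4_eq_xxxx)

lemma fourth_roots_cancel:
  assumes "w \<in> fourth_roots"
  shows "w * (w * (w * w)) = 1" "w * (w * (w * (w * x))) = x"
proof -
  show 1: "w * (w * (w * w)) = 1"
    using fourth_roots_power[OF assms] by (simp add: power4_eq_xxxx mult.assoc)
  have "w * (w * (w * (w * x))) = w * (w * (w * w)) * x" by (simp only: mult.assoc)
  then show "w * (w * (w * (w * x))) = x" by (simp add: 1)
qed

lemma fourth_roots_uminus: "w \<in> fourth_roots \<Longrightarrow> - w \<in> fourth_roots"
  by (auto simp: fourth_roots_def)

lemma sum_fourth_roots: "(\<Sum>w\<in>fourth_roots. f w) = f 1 + f \<i> + f (- 1) + f (- \<i>)"
  by (simp add: fourth_roots_def complex_eq_iff add.assoc)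

lemma K_K_idem: "w \<in> fourth_roots \<Longrightarrow> K\<^sub>Q * K_idem w = w *\<^sub>C K_idem w"
proof -
  assume w: "w \<in> fourth_roots"
  have "K\<^sub>Q * K\<^sub>Q ^ 2 = K\<^sub>Q ^ 3" "K\<^sub>Q * K\<^sub>Q ^ 3 = 1"
    by (simp_all add: Q_relations flip: power_Suc)
  moreover have "w * w ^ 3 = 1" "w * w ^ 2 = w ^ 3"
    using fourth_roots_power[OF w] by (simp_all flip: power_Suc)
  ultimately show ?thesis
    by (simp add: K_idem_def distrib_left mult_scaleC_right scaleC_scaleC scaleC_add_right
        power2_eq_square scaleC_one mult.commute mult.left_commute add_ac)
qed

lemma K_idem_K: "K_idem w * K\<^sub>Q = K\<^sub>Q * K_idem w"
  by (simp add: K_idem_def algebra_simps mult_scaleC_left mult_scaleC_right power_commutes)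

lemma K_idem_E: "K_idem w * E\<^sub>Q = E\<^sub>Q * K_idem (- w)"
  and K_idem_F: "K_idem w * F\<^sub>Q = F\<^sub>Q * K_idem (- w)"
proof -
  have "K_idem w * x = x * K_idem (- w)" if "K\<^sub>Q * x = - (x * K\<^sub>Q)" for x
  proof -
    have 1: "K\<^sub>Q * (x * y) = - (x * (K\<^sub>Q * y))" for y
      using that by (simp add: mult.assoc[symmetric])
    show ?thesis
      by (simp add: K_idem_def distrib_left distrib_right mult_scaleC_left mult_scaleC_right
          left_diff_distrib right_diff_distrib that 1 power2_eq_square power3_eq_cube mult.assoc)
  qed
  then show "K_idem w * E\<^sub>Q = E\<^sub>Q * K_idem (- w)" "K_idem w * F\<^sub>Q = F\<^sub>Q * K_idem (- w)"
    by (simp_all add: Q_commute)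
qed

lemma sum_K_idem: "(\<Sum>w\<in>fourth_roots. K_idem w) = 1"
  by (rule functionals_separate)
    (simp add: sum_fourth_roots K_idem_def functional_simps power3_eq_cube power2_eq_square algebra_simps)

lemma E_E_left: "E\<^sub>Q * (E\<^sub>Q * x) = 0"
  by (simp add: Q_relations flip: mult.assoc)

lemma F_F_left: "F\<^sub>Q * (F\<^sub>Q * x) = 0"
  by (simp add: Q_relations flip: mult.assoc)

text \<open>The scalar by which [E, F] = (K - K^-1) / (2 i) acts where K has eigenvalue
  \<open>w\<close>: zero at 1 and -1, and 1 and -1 at i and -i.\<close>

definition K_weight :: "complex \<Rightarrow> complex" where
  "K_weight w = (w - w ^ 3) / (2 * \<i>)"

lemma F_E_K_idem:
  assumes w: "w \<in> fourth_roots"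
  shows "F\<^sub>Q * (E\<^sub>Q * K_idem w) = E\<^sub>Q * (F\<^sub>Q * K_idem w) - K_weight w *\<^sub>C K_idem w"
proof -
  have 3: "K\<^sub>Q ^ 3 * K_idem w = w ^ 3 *\<^sub>C K_idem w"
    by (simp add: power3_eq_cube mult.assoc K_K_idem[OF w] mult_scaleC_right scaleC_scaleC)
  have "F\<^sub>Q * E\<^sub>Q = E\<^sub>Q * F\<^sub>Q - (1 / (2 * \<i>)) *\<^sub>C (K\<^sub>Q - K\<^sub>Q ^ 3)"
    using Q_relations(5) by (simp add: Kinv_eq algebra_simps)
  then have "F\<^sub>Q * E\<^sub>Q * K_idem w = E\<^sub>Q * F\<^sub>Q * K_idem w - K_weight w *\<^sub>C K_idem w"
    by (simp add: left_diff_distrib mult_scaleC_left K_K_idem[OF w] 3 cvs.scale_right_diff_distrib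
        scaleC_scaleC K_weight_def cvs.scale_left_diff_distrib right_diff_distrib diff_divide_distrib)
  then show ?thesis by (simp add: mult.assoc)
qed

lemma K_weight_uminus: "K_weight (- w) = - K_weight w"
  by (simp add: K_weight_def field_simps)

lemma F_E_F_K_idem:
  assumes w: "w \<in> fourth_roots"
  shows "F\<^sub>Q * (E\<^sub>Q * (F\<^sub>Q * K_idem w)) = K_weight w *\<^sub>C (F\<^sub>Q * K_idem w)"
proof -
  have "F\<^sub>Q * (E\<^sub>Q * (F\<^sub>Q * K_idem w)) = F\<^sub>Q * (E\<^sub>Q * K_idem (- w)) * F\<^sub>Q"
    by (simp add: mult.assoc K_idem_F)
  also have "\<dots> = K_weight w *\<^sub>C (F\<^sub>Q * K_idem w)"
    by (simp add: F_E_K_idem fourth_roots_uminus w distrib_right mult.assoc K_idem_F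
        mult_scaleC_left K_weight_uminus F_F_left)
  finally show ?thesis .
qed

lemma K_left:
  "K\<^sub>Q * (E\<^sub>Q * x) = - (E\<^sub>Q * (K\<^sub>Q * x))" "K\<^sub>Q * (F\<^sub>Q * x) = - (F\<^sub>Q * (K\<^sub>Q * x))"
  by (simp_all add: Q_commute flip: mult.assoc)

lemma Kinv_left:
  "Kinv\<^sub>Q * (E\<^sub>Q * x) = - (E\<^sub>Q * (Kinv\<^sub>Q * x))" "Kinv\<^sub>Q * (F\<^sub>Q * x) = - (F\<^sub>Q * (Kinv\<^sub>Q * x))"
  by (simp_all add: Q_commute flip: mult.assoc)

lemma Kinv_K_idem: "w \<in> fourth_roots \<Longrightarrow> Kinv\<^sub>Q * K_idem w = w ^ 3 *\<^sub>C K_idem w"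
  by (simp add: Kinv_eq power3_eq_cube mult.assoc K_K_idem mult_scaleC_right scaleC_scaleC)

section \<open>Spanning and independence of the words\<close>

definition pbw_comb :: "complex \<Rightarrow> (bool \<Rightarrow> bool \<Rightarrow> complex) \<Rightarrow> Q" where
  "pbw_comb w c = c False False *\<^sub>C K_idem w + c False True *\<^sub>C (F\<^sub>Q * K_idem w) +
     c True False *\<^sub>C (E\<^sub>Q * K_idem w) + c True True *\<^sub>C (E\<^sub>Q * (F\<^sub>Q * K_idem w))"

(* The action of Q by left multiplication on Q * K_idem w, in the coordinates c a b with respect to
   the words E^a F^b K_idem w. That it respects Qrel yields the linear independence of the words. *)
primrec left_mult :: "complex \<Rightarrow> Qterm \<Rightarrow> (bool \<Rightarrow> bool \<Rightarrow> complex) \<Rightarrow> bool \<Rightarrow> bool \<Rightarrow> complex" where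
  "left_mult w (Scal r) = (\<lambda>c a b. r * c a b)"
| "left_mult w GE = (\<lambda>c a b. if a then c False b else 0)"
| "left_mult w GF = (\<lambda>c a b. if a then (if b then c True False else 0)
     else if b then c False False + K_weight w * c True True else - K_weight w * c True False)"
| "left_mult w GK = (\<lambda>c a b. (if a = b then w else - w) * c a b)"
| "left_mult w GKinv = (\<lambda>c a b. (if a = b then w ^ 3 else - (w ^ 3)) * c a b)"
| "left_mult w (Add x y) = (\<lambda>c a b. left_mult w x c a b + left_mult w y c a b)"
| "left_mult w (Mul x y) = (\<lambda>c. left_mult w x (left_mult w y c))"

lemma left_mult_linear:
  "left_mult w t (\<lambda>a b. c a b + d a b) = (\<lambda>a b. left_mult w t c a b + left_mult w t d a b)"
  "left_mult w t (\<lambda>a b. r * c a b) = (\<lambda>a b. r * left_mult w t c a b)"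
proof (induction t arbitrary: c d)
  case (Mul t1 t2)
  {
    case 1
    show ?case by (simp add: Mul.IH)
  next
    case 2
    show ?case by (simp add: Mul.IH)
  }
qed (auto simp: fun_eq_iff algebra_simps)

lemma left_mult_cong:
  assumes "Qrel x y" and w: "w \<in> fourth_roots"
  shows "left_mult w x = left_mult w y"
  using assms(1)
proof induction
  case EF_commutator
  show ?case by (auto simp: fun_eq_iff K_weight_def field_simps)
next
  case (Mul_cong x x' y y')
  then show ?case by simp
qed (use w in \<open>auto simp: fun_eq_iff left_mult_linear algebra_simps power4_eq_xxxx power3_eq_cube
    fourth_roots_cancel\<close>)

text \<open>For any other \<open>w\<close> the relation \<open>K_fourth\<close> is violated, so a
  dummy value is needed to lift to \<open>Q\<close>.\<close>

lift_definition pbw_action :: "complex \<Rightarrow> Q \<Rightarrow> (bool \<Rightarrow> bool \<Rightarrow> complex) \<Rightarrow> bool \<Rightarrow> bool \<Rightarrow> complex"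
  is "\<lambda>w t. if w \<in> fourth_roots then left_mult w t else (\<lambda>_ _ _. 0)"
  by (auto simp: left_mult_cong)

text \<open>The formulas of \<open>left_mult\<close> are what straightening of words produces in
  \<open>Q\<close>. This gives spanning (\<open>pbw_expansion\<close>); independence comes from
  \<open>pbw_coord_pbw_comb\<close>.\<close>

lemma mult_pbw_comb:
  assumes w: "w \<in> fourth_roots"
  shows "x * pbw_comb w c = pbw_comb w (pbw_action w x c)"
proof -
  have "abs_Q t * pbw_comb w c = pbw_comb w (left_mult w t c)" for t
  proof (induction t arbitrary: c)
    case (Scal r)
    have "abs_Q (Scal r) * x = r *\<^sub>C x" for x by transfer (rule Qrel.refl)
    then show ?case by (simp add: pbw_comb_def scaleC_add_right scaleC_scaleC)
  next
    case (Add t1 t2)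
    then show ?case
      by (simp add: distrib_right pbw_comb_def scaleC_add_left add_ac flip: plus_Q.abs_eq)
  next
    case (Mul t1 t2)
    then show ?case by (simp add: mult.assoc flip: times_Q.abs_eq)
  qed (simp_all add: pbw_comb_def distrib_left mult_scaleC_right E_E_left F_F_left K_left Kinv_left
      F_E_K_idem F_E_F_K_idem K_K_idem Kinv_K_idem w scaleC_scaleC scaleC_add_left
      cvs.scale_right_diff_distrib mult.commute add_ac
      flip: E\<^sub>Q.abs_eq F\<^sub>Q.abs_eq K\<^sub>Q.abs_eq Kinv\<^sub>Q.abs_eq)
  from this[of "rep_Q x"] w show ?thesis
    by (simp add: pbw_action_def Quotient_abs_rep[OF Quotient_Q])
qed

definition pbw_one :: "bool \<Rightarrow> bool \<Rightarrow> complex" where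
  "pbw_one a b = of_bool (\<not> a \<and> \<not> b)"

text \<open>\<open>pbw_one\<close> is the coordinate vector of \<open>K_idem w\<close>, so acting on
  it gives the coordinates of \<open>x * K_idem w\<close>.\<close>

definition pbw_coord :: "complex \<Rightarrow> bool \<Rightarrow> bool \<Rightarrow> Q \<Rightarrow> complex" where
  "pbw_coord w a b x = pbw_action w x pbw_one a b"

lemma pbw_expansion: "x = (\<Sum>w\<in>fourth_roots. pbw_comb w (\<lambda>a b. pbw_coord w a b x))"
proof -
  have "x = (\<Sum>w\<in>fourth_roots. x * pbw_comb w pbw_one)"
    by (simp add: pbw_comb_def pbw_one_def scaleC_one sum_K_idem flip: sum_distrib_left)
  also have "\<dots> = (\<Sum>w\<in>fourth_roots. pbw_comb w (\<lambda>a b. pbw_coord w a b x))"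
  proof (rule sum.cong[OF HOL.refl])
    fix w assume "w \<in> fourth_roots"
    from mult_pbw_comb[OF this] show "x * pbw_comb w pbw_one = pbw_comb w (\<lambda>a b. pbw_coord w a b x)"
      by (simp only: pbw_coord_def)
  qed
  finally show ?thesis .
qed

lemma pbw_action_simps:
  assumes "w \<in> fourth_roots"
  shows "pbw_action w (x + y) c = (\<lambda>a b. pbw_action w x c a b + pbw_action w y c a b)"
    "pbw_action w (x * y) c = pbw_action w x (pbw_action w y c)"
    "pbw_action w (r *\<^sub>C x) c = (\<lambda>a b. r * pbw_action w x c a b)"
    "pbw_action w 1 c = c"
    "pbw_action w E\<^sub>Q c = left_mult w GE c" "pbw_action w F\<^sub>Q c = left_mult w GF c"
    "pbw_action w K\<^sub>Q c = left_mult w GK c"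
  using assms by (transfer, simp)+

lemma functional_pbw_coord: "w \<in> fourth_roots \<Longrightarrow> functional (pbw_coord w a b)"
  by (rule functionalI) (simp_all add: pbw_coord_def pbw_action_simps algebra_simps)

lemma pbw_coord_pbw_comb:
  assumes w: "w \<in> fourth_roots" and v: "v \<in> fourth_roots"
  shows "pbw_coord w a b (pbw_comb v c) = (if w = v then c a b else 0)"
proof -
  \<comment> \<open>Orthogonality of the characters of the cyclic group of order four.\<close>
  have "1 + v ^ 3 * w + v\<^sup>2 * w\<^sup>2 + v * w ^ 3 = (if w = v then 4 else 0)"
    using assms unfolding fourth_roots_def
    by (elim insertE emptyE) (simp_all add: power3_eq_cube power2_eq_square fourth_roots_distinct)
  then have *: "pbw_action w (K_idem v) pbw_one = (\<lambda>a b. of_bool (w = v) * pbw_one a b)"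
    by (auto simp: fun_eq_iff K_idem_def pbw_action_simps[OF w] pbw_one_def power3_eq_cube
        power2_eq_square mult.assoc)
  show ?thesis
    by (simp add: pbw_coord_def pbw_comb_def pbw_action_simps[OF w] * pbw_one_def)
qed

section \<open>The monodromy matrix\<close>

lemma functional_dual_apply: "functional (dual_apply f)"
  using dual_apply by auto

lemma tensor_induct [case_names zero pure add]:
  assumes "P 0" "\<And>a b. P (a \<otimes> b)" "\<And>x y. P x \<Longrightarrow> P y \<Longrightarrow> P (x + y)"
  shows "P (x :: ('a::complex_algebra, 'b::complex_algebra) tensor)"
proof -
  have "P (abs_tensor A)" for A
  proof (induction A)
    case empty
    show ?case using assms(1) by (simp add: zero_tensor.abs_eq)
  next
    case (add p A)
    obtain a b where "p = (a, b)" by force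
    then have "abs_tensor (add_mset p A) = a \<otimes> b + abs_tensor A"
      by (simp add: pure_tensor.abs_eq plus_tensor.abs_eq)
    with add assms show ?case by simp
  qed
  from this[of "rep_tensor x"] show ?thesis by (simp add: Quotient_abs_rep[OF Quotient_tensor])
qed

lemma tensor_contract_simps:
  "tensor_contract f (x + y) = tensor_contract f x + tensor_contract f y"
  "tensor_contract f (a \<otimes> b) = dual_apply f a *\<^sub>C b"
  "tensor_contract f 0 = 0"
  by (transfer, simp)+

lemma tensor_contract_scaleC: "tensor_contract f (c *\<^sub>C x) = c *\<^sub>C tensor_contract f x"
  by (induction x rule: tensor_induct)
    (simp_all add: tensor_contract_simps scaleC_add_right scaleC_scaleC
      functional_simps[OF functional_dual_apply] flip: pure_tensor_scaleC_left)

lemma tensor_contract_diff: "tensor_contract f (x - y) = tensor_contract f x - tensor_contract f y"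
  using tensor_contract_simps(1)[of f "x - y" y] by (simp add: algebra_simps)

lemma tensor_flip_simps:
  "tensor_flip (x + y) = tensor_flip x + tensor_flip y"
  "tensor_flip (a \<otimes> b) = b \<otimes> a"
  "tensor_flip 0 = 0"
  by (transfer, simp add: tensor_eq.refl)+

lemma tensor_flip_scaleC: "tensor_flip (c *\<^sub>C x) = c *\<^sub>C tensor_flip x"
proof (induction x rule: tensor_induct)
  case (pure a b)
  have "tensor_flip (c *\<^sub>C (a \<otimes> b)) = tensor_flip ((c *\<^sub>C a) \<otimes> b)"
    by (simp only: pure_tensor_scaleC_left)
  then show ?case by (simp only: tensor_flip_simps pure_tensor_scaleC_right)
qed (simp_all add: tensor_flip_simps scaleC_add_right)

lemma tensor_flip_diff: "tensor_flip (x - y) = tensor_flip x - tensor_flip y"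
  using tensor_flip_simps(1)[of "x - y" y] by (simp add: algebra_simps)

lemma tensor_flip_mult: "tensor_flip (x * y) = tensor_flip x * tensor_flip y"
proof (induction x rule: tensor_induct)
  case (pure a b)
  show ?case
    by (induction y rule: tensor_induct)
      (simp_all add: tensor_flip_simps pure_tensor_mult distrib_left)
qed (simp_all add: tensor_flip_simps distrib_right)

text \<open>On the projection for \<open>w\<close>, K^2 is w^2; so \<open>e0\<close> selects the
  roots 1, -1 and \<open>e1\<close> the roots i, -i. Every formula for R therefore splits into four
  parity cases.\<close>

lemma even_root:
  assumes "a \<in> {1, - 1}"
  shows "a \<in> fourth_roots" "a * a = 1" "a * (a * x) = x" "K_weight a = 0"
    "e0 * K_idem a = K_idem a" "e1 * K_idem a = 0"
proof -
  show 1: "a \<in> fourth_roots" "a * a = 1" "K_weight a = 0"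
    using assms by (auto simp: fourth_roots_def K_weight_def)
  show "a * (a * x) = x" using 1(2) by (simp flip: mult.assoc)
  show "e0 * K_idem a = K_idem a" "e1 * K_idem a = 0"
    by (rule functionals_separate, simp add: e0_def e1_def mult_scaleC_left distrib_right
        left_diff_distrib mult.assoc power2_eq_square K_K_idem 1 mult_scaleC_right scaleC_scaleC
        scaleC_one functional_simps)+
qed

lemma odd_root:
  assumes "a \<in> {\<i>, - \<i>}"
  shows "a \<in> fourth_roots" "a * a = - 1" "a * (a * x) = - x" "K_weight a = - \<i> * a"
    "e0 * K_idem a = 0" "e1 * K_idem a = K_idem a"
proof -
  show 1: "a \<in> fourth_roots" "a * a = - 1" "K_weight a = - \<i> * a"
    using assms by (auto simp: fourth_roots_def K_weight_def power3_eq_cube)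
  have "a * (a * x) = (a * a) * x" by (simp only: mult.assoc)
  then show "a * (a * x) = - x" by (simp add: 1)
  show "e0 * K_idem a = 0" "e1 * K_idem a = K_idem a"
    by (rule functionals_separate, simp add: e0_def e1_def mult_scaleC_left distrib_right
        left_diff_distrib mult.assoc power2_eq_square K_K_idem 1 mult_scaleC_right scaleC_scaleC
        scaleC_one functional_simps)+
qed

lemmas word_simps = distrib_left distrib_right left_diff_distrib right_diff_distrib
  mult_scaleC_left mult_scaleC_right pure_tensor_mult mult.assoc K_left K_K_idem
  pure_tensor_scaleC_left pure_tensor_scaleC_right pure_tensor_uminus pure_tensor_zero scaleC_scaleC
  scaleC_add_right cvs.scale_right_diff_distrib

text \<open>A pair of idempotents isolates one of the four blocks of R. The prefactor in K stands
  left of the words, so it is evaluated at (a, b) in front of words of even length in each factor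
  and at (-a, -b) in front of single letters.\<close>

lemma Rmatrix_even_even:
  assumes a: "a \<in> {1, - 1}" and b: "b \<in> {1, - 1}"
  shows "Rmatrix \<beta> * (K_idem a \<otimes> K_idem b) =
    ((1 + a + b - a * b) / 2) *\<^sub>C (K_idem a \<otimes> K_idem b) +
    (\<i> * (1 - a - b - a * b)) *\<^sub>C ((E\<^sub>Q * K_idem a) \<otimes> (F\<^sub>Q * K_idem b))"
proof -
  have "Rmatrix \<beta> * (K_idem a \<otimes> K_idem b) = R00 * (K_idem a \<otimes> K_idem b)"
    by (simp add: Rmatrix_def distrib_right mult.assoc pure_tensor_mult pure_tensor_zero
        even_root[OF a] even_root[OF b])
  then show ?thesis unfolding R00_def
    by (intro functionals_separate)
      (simp add: word_simps even_root(1)[OF a] even_root(1)[OF b] functional_simps)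
qed

lemma Rmatrix_even_odd:
  assumes a: "a \<in> {1, - 1}" and b: "b \<in> {\<i>, - \<i>}"
  defines "c \<equiv> \<lambda>x y. (1 - \<i> * y + x + \<i> * x * y) / 2"
  shows "Rmatrix \<beta> * (K_idem a \<otimes> K_idem b) =
    c a b *\<^sub>C (K_idem a \<otimes> K_idem b) +
    ((1 - \<i>) * a * b * c (- a) (- b)) *\<^sub>C ((F\<^sub>Q * K_idem a) \<otimes> (E\<^sub>Q * K_idem b)) -
    ((1 - \<i>) * c (- a) (- b)) *\<^sub>C ((E\<^sub>Q * K_idem a) \<otimes> (F\<^sub>Q * K_idem b)) +
    ((1 + \<i>) * a * c a b) *\<^sub>C ((E\<^sub>Q * (F\<^sub>Q * K_idem a)) \<otimes> K_idem b) +
    (2 * \<i> * a * b * c a b) *\<^sub>C ((E\<^sub>Q * (F\<^sub>Q * K_idem a)) \<otimes> (E\<^sub>Q * (F\<^sub>Q * K_idem b)))"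
proof -
  have "Rmatrix \<beta> * (K_idem a \<otimes> K_idem b) = R01 * (K_idem a \<otimes> K_idem b)"
    by (simp add: Rmatrix_def distrib_right mult.assoc pure_tensor_mult pure_tensor_zero
        even_root[OF a] odd_root[OF b])
  then show ?thesis unfolding R01_def c_def
    by (intro functionals_separate)
      (simp add: word_simps even_root(1)[OF a] odd_root(1)[OF b] functional_simps, simp add: field_simps)
qed

lemma Rmatrix_odd_even:
  assumes a: "a \<in> {\<i>, - \<i>}" and b: "b \<in> {1, - 1}"
  defines "c \<equiv> \<lambda>x y. (1 + y - \<i> * x + \<i> * x * y) / 2"
  shows "Rmatrix \<beta> * (K_idem a \<otimes> K_idem b) =
    (b * c a b) *\<^sub>C (K_idem a \<otimes> K_idem b) +
    ((1 - \<i>) * a * c (- a) (- b)) *\<^sub>C ((F\<^sub>Q * K_idem a) \<otimes> (E\<^sub>Q * K_idem b)) +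
    ((1 - \<i>) * b * c (- a) (- b)) *\<^sub>C ((E\<^sub>Q * K_idem a) \<otimes> (F\<^sub>Q * K_idem b)) -
    ((1 - \<i>) * c a b) *\<^sub>C (K_idem a \<otimes> (E\<^sub>Q * (F\<^sub>Q * K_idem b))) -
    (2 * \<i> * a * c a b) *\<^sub>C ((E\<^sub>Q * (F\<^sub>Q * K_idem a)) \<otimes> (E\<^sub>Q * (F\<^sub>Q * K_idem b)))"
proof -
  have "Rmatrix \<beta> * (K_idem a \<otimes> K_idem b) = R10 * (K_idem a \<otimes> K_idem b)"
    by (simp add: Rmatrix_def distrib_right mult.assoc pure_tensor_mult pure_tensor_zero
        odd_root[OF a] even_root[OF b])
  then show ?thesis unfolding R10_def c_def
    by (intro functionals_separate)
      (simp add: word_simps odd_root(1)[OF a] even_root(1)[OF b] functional_simps, simp add: field_simps)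
qed

lemma Rmatrix_odd_odd:
  assumes a: "a \<in> {\<i>, - \<i>}" and b: "b \<in> {\<i>, - \<i>}"
  defines "c \<equiv> \<lambda>x y. (1 - \<i> * y - \<i> * x + x * y) / 2"
  shows "Rmatrix \<beta> * (K_idem a \<otimes> K_idem b) =
    \<beta> *\<^sub>C (- (\<i> * a * c a b) *\<^sub>C (K_idem a \<otimes> K_idem b) +
    (2 * \<i> * a * c (- a) (- b)) *\<^sub>C ((E\<^sub>Q * K_idem a) \<otimes> (F\<^sub>Q * K_idem b)) +
    ((1 - \<i>) * a * b * c a b) *\<^sub>C (K_idem a \<otimes> (E\<^sub>Q * (F\<^sub>Q * K_idem b))) -
    ((1 + \<i>) * c a b) *\<^sub>C ((E\<^sub>Q * (F\<^sub>Q * K_idem a)) \<otimes> K_idem b) -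
    (2 * \<i> * b * c a b) *\<^sub>C ((E\<^sub>Q * (F\<^sub>Q * K_idem a)) \<otimes> (E\<^sub>Q * (F\<^sub>Q * K_idem b))))"
proof -
  have "Rmatrix \<beta> * (K_idem a \<otimes> K_idem b) = R11 \<beta> * (K_idem a \<otimes> K_idem b)"
    by (simp add: Rmatrix_def distrib_right mult.assoc pure_tensor_mult pure_tensor_zero
        odd_root[OF a] odd_root[OF b])
  then show ?thesis unfolding R11_def c_def
    by (intro functionals_separate)
      (simp add: word_simps odd_root(1)[OF a] odd_root(1)[OF b] functional_simps, simp add: field_simps)
qed

lemma flip_Rmatrix_K_idem:
  "tensor_flip (Rmatrix \<beta>) * (K_idem a \<otimes> K_idem b) = tensor_flip (Rmatrix \<beta> * (K_idem b \<otimes> K_idem a))"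
  by (simp add: tensor_flip_mult tensor_flip_simps)

text \<open>Words are moved to the right of the idempotents, so that multiplying the R-matrix
  formulas by R_21 requires R_21 on pairs of idempotents only, where
  \<open>flip_Rmatrix_K_idem\<close> applies.\<close>

lemma mult_pure_word:
  "t * (K_idem a \<otimes> (E\<^sub>Q * (F\<^sub>Q * K_idem b))) = t * (K_idem a \<otimes> K_idem b) * (1 \<otimes> (E\<^sub>Q * F\<^sub>Q))"
  "t * ((E\<^sub>Q * (F\<^sub>Q * K_idem a)) \<otimes> K_idem b) = t * (K_idem a \<otimes> K_idem b) * ((E\<^sub>Q * F\<^sub>Q) \<otimes> 1)"
  "t * ((E\<^sub>Q * (F\<^sub>Q * K_idem a)) \<otimes> (E\<^sub>Q * (F\<^sub>Q * K_idem b)))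
    = t * (K_idem a \<otimes> K_idem b) * ((E\<^sub>Q * F\<^sub>Q) \<otimes> (E\<^sub>Q * F\<^sub>Q))"
  "t * ((E\<^sub>Q * K_idem a) \<otimes> (F\<^sub>Q * K_idem b)) = t * (K_idem (- a) \<otimes> K_idem (- b)) * (E\<^sub>Q \<otimes> F\<^sub>Q)"
  "t * ((F\<^sub>Q * K_idem a) \<otimes> (E\<^sub>Q * K_idem b)) = t * (K_idem (- a) \<otimes> K_idem (- b)) * (F\<^sub>Q \<otimes> E\<^sub>Q)"
proof -
  have "K_idem b * (E\<^sub>Q * F\<^sub>Q) = E\<^sub>Q * (F\<^sub>Q * K_idem b)" for b
    by (metis K_idem_E K_idem_F minus_minus mult.assoc)
  then show "t * (K_idem a \<otimes> (E\<^sub>Q * (F\<^sub>Q * K_idem b))) = t * (K_idem a \<otimes> K_idem b) * (1 \<otimes> (E\<^sub>Q * F\<^sub>Q))"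
  "t * ((E\<^sub>Q * (F\<^sub>Q * K_idem a)) \<otimes> K_idem b) = t * (K_idem a \<otimes> K_idem b) * ((E\<^sub>Q * F\<^sub>Q) \<otimes> 1)"
  "t * ((E\<^sub>Q * (F\<^sub>Q * K_idem a)) \<otimes> (E\<^sub>Q * (F\<^sub>Q * K_idem b)))
    = t * (K_idem a \<otimes> K_idem b) * ((E\<^sub>Q * F\<^sub>Q) \<otimes> (E\<^sub>Q * F\<^sub>Q))"
    by (simp_all add: mult.assoc pure_tensor_mult)
qed (simp_all add: mult.assoc pure_tensor_mult K_idem_E K_idem_F)

lemma K_idem_word:
  "K_idem a * E\<^sub>Q = E\<^sub>Q * K_idem (- a)" "K_idem a * (E\<^sub>Q * x) = E\<^sub>Q * (K_idem (- a) * x)"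
  "K_idem a * F\<^sub>Q = F\<^sub>Q * K_idem (- a)" "K_idem a * (F\<^sub>Q * x) = F\<^sub>Q * (K_idem (- a) * x)"
  by (simp_all add: K_idem_E K_idem_F flip: mult.assoc)

lemmas monodromy_simps = tensor_flip_simps tensor_flip_diff tensor_flip_scaleC distrib_left distrib_right
  left_diff_distrib right_diff_distrib mult_scaleC_left mult_scaleC_right pure_tensor_mult mult.assoc
  K_idem_word E_E_left F_F_left F_E_K_idem F_E_F_K_idem K_weight_uminus
  pure_tensor_scaleC_left pure_tensor_scaleC_right pure_tensor_uminus pure_tensor_zero pure_tensor_diff
  pure_tensor_add_left pure_tensor_add_right

lemmas monodromy_expand = distrib_left[of "tensor_flip (Rmatrix \<beta>)"]
  right_diff_distrib[of "tensor_flip (Rmatrix \<beta>)"] mult_scaleC_right[of "tensor_flip (Rmatrix \<beta>)"]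
  mult_pure_word[of "tensor_flip (Rmatrix \<beta>)"] flip_Rmatrix_K_idem for \<beta>

lemma minus_even: "a \<in> {1, - 1} \<Longrightarrow> - a \<in> {1, - 1 :: complex}" by auto
lemma minus_odd: "a \<in> {\<i>, - \<i>} \<Longrightarrow> - a \<in> {\<i>, - \<i> :: complex}" by auto

text \<open>In this and the next three lemmas the prefactors of R and R_21 combine so that all
  coefficients become monomials in \<open>a\<close> and \<open>b\<close>. The constant \<beta>
  survives only in the odd-odd block, as its square.\<close>

lemma monodromy_even_even:
  assumes a: "a \<in> {1, - 1}" and b: "b \<in> {1, - 1}"
  shows "monodromy \<beta> * (K_idem a \<otimes> K_idem b) =
    (K_idem a \<otimes> K_idem b) +
    (2 * \<i>) *\<^sub>C ((E\<^sub>Q * K_idem a) \<otimes> (F\<^sub>Q * K_idem b)) -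
    (2 * \<i> * a * b) *\<^sub>C ((F\<^sub>Q * K_idem a) \<otimes> (E\<^sub>Q * K_idem b)) +
    (4 * a * b) *\<^sub>C ((E\<^sub>Q * (F\<^sub>Q * K_idem a)) \<otimes> (E\<^sub>Q * (F\<^sub>Q * K_idem b)))"
    (is "?l = ?r")
proof (rule functionals_separate)
  fix g :: "(Q, Q) tensor \<Rightarrow> complex"
  assume g: "functional g"
  show "g ?l = g ?r"
    unfolding monodromy_def mult.assoc[of _ "Rmatrix \<beta>"] Rmatrix_even_even[OF a b] monodromy_expand
      Rmatrix_even_even[OF b a] Rmatrix_even_even[OF minus_even[OF b] minus_even[OF a]]
    by (simp add: monodromy_simps functional_simps[OF g] even_root[OF a] even_root[OF b])
      (use a b in \<open>auto simp: algebra_simps power2_eq_square add_divide_distrib diff_divide_distrib\<close>)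
qed

lemma monodromy_even_odd:
  assumes a: "a \<in> {1, - 1}" and b: "b \<in> {\<i>, - \<i>}"
  shows "monodromy \<beta> * (K_idem a \<otimes> K_idem b) =
    a *\<^sub>C (K_idem a \<otimes> K_idem b) -
    (2 * \<i> * a) *\<^sub>C ((E\<^sub>Q * K_idem a) \<otimes> (F\<^sub>Q * K_idem b)) +
    (2 * \<i> * b) *\<^sub>C ((F\<^sub>Q * K_idem a) \<otimes> (E\<^sub>Q * K_idem b)) +
    (4 * b) *\<^sub>C ((E\<^sub>Q * (F\<^sub>Q * K_idem a)) \<otimes> (E\<^sub>Q * (F\<^sub>Q * K_idem b)))"
    (is "?l = ?r")
proof (rule functionals_separate)
  fix g :: "(Q, Q) tensor \<Rightarrow> complex"
  assume g: "functional g"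
  show "g ?l = g ?r"
    unfolding monodromy_def mult.assoc[of _ "Rmatrix \<beta>"] Rmatrix_even_odd[OF a b] monodromy_expand
      Rmatrix_odd_even[OF b a] Rmatrix_odd_even[OF minus_odd[OF b] minus_even[OF a]]
    by (simp add: monodromy_simps functional_simps[OF g] even_root[OF a] odd_root[OF b])
      (use a b in \<open>auto simp: algebra_simps power2_eq_square add_divide_distrib diff_divide_distrib\<close>)
qed

lemma monodromy_odd_even:
  assumes a: "a \<in> {\<i>, - \<i>}" and b: "b \<in> {1, - 1}"
  shows "monodromy \<beta> * (K_idem a \<otimes> K_idem b) =
    (b) *\<^sub>C (K_idem a \<otimes> K_idem b) -
    (2 * \<i> * b) *\<^sub>C ((E\<^sub>Q * K_idem a) \<otimes> (F\<^sub>Q * K_idem b)) -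
    (2 * \<i> * a) *\<^sub>C ((F\<^sub>Q * K_idem a) \<otimes> (E\<^sub>Q * K_idem b)) +
    (4 * \<i>) *\<^sub>C (K_idem a \<otimes> (E\<^sub>Q * (F\<^sub>Q * K_idem b))) -
    (4 * a) *\<^sub>C ((E\<^sub>Q * (F\<^sub>Q * K_idem a)) \<otimes> (E\<^sub>Q * (F\<^sub>Q * K_idem b)))"
    (is "?l = ?r")
proof (rule functionals_separate)
  fix g :: "(Q, Q) tensor \<Rightarrow> complex"
  assume g: "functional g"
  show "g ?l = g ?r"
    unfolding monodromy_def mult.assoc[of _ "Rmatrix \<beta>"] Rmatrix_odd_even[OF a b] monodromy_expand
      Rmatrix_even_odd[OF b a] Rmatrix_even_odd[OF minus_even[OF b] minus_odd[OF a]]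
    by (simp add: monodromy_simps functional_simps[OF g] odd_root[OF a] even_root[OF b])
      (use a b in \<open>auto simp: algebra_simps power2_eq_square add_divide_distrib diff_divide_distrib\<close>)
qed

lemma monodromy_odd_odd:
  assumes a: "a \<in> {\<i>, - \<i>}" and b: "b \<in> {\<i>, - \<i>}"
  shows "monodromy \<beta> * (K_idem a \<otimes> K_idem b) =
    \<beta>\<^sup>2 *\<^sub>C ((4 * \<i> * a) *\<^sub>C (K_idem a \<otimes> (E\<^sub>Q * (F\<^sub>Q * K_idem b))) - (a * b) *\<^sub>C (K_idem a \<otimes> K_idem b) -
    (2 * \<i> * a * b) *\<^sub>C ((E\<^sub>Q * K_idem a) \<otimes> (F\<^sub>Q * K_idem b)) -
    (2 * \<i>) *\<^sub>C ((F\<^sub>Q * K_idem a) \<otimes> (E\<^sub>Q * K_idem b)) +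
    (4) *\<^sub>C ((E\<^sub>Q * (F\<^sub>Q * K_idem a)) \<otimes> (E\<^sub>Q * (F\<^sub>Q * K_idem b))))"
    (is "?l = ?r")
proof (rule functionals_separate)
  fix g :: "(Q, Q) tensor \<Rightarrow> complex"
  assume g: "functional g"
  show "g ?l = g ?r"
    unfolding monodromy_def mult.assoc[of _ "Rmatrix \<beta>"] Rmatrix_odd_odd[OF a b] monodromy_expand
      Rmatrix_odd_odd[OF b a] Rmatrix_odd_odd[OF minus_odd[OF b] minus_odd[OF a]]
    by (simp add: monodromy_simps functional_simps[OF g] odd_root[OF a] odd_root[OF b])
      (use a b in \<open>auto simp: algebra_simps power2_eq_square add_divide_distrib diff_divide_distrib\<close>)
qed

section \<open>The Drinfeld and Radford maps in coordinates\<close>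

lemma tensor_contract_uminus: "tensor_contract f (- x) = - tensor_contract f x"
  using tensor_contract_diff[of f 0 x] by (simp add: tensor_contract_simps)

definition pbw_word :: "complex \<Rightarrow> bool \<Rightarrow> bool \<Rightarrow> Q" where
  "pbw_word w p q = (if p then E\<^sub>Q * (if q then F\<^sub>Q * K_idem w else K_idem w)
     else if q then F\<^sub>Q * K_idem w else K_idem w)"

text \<open>Coordinate functions accept every complex \<open>w\<close>, but only their values at the
  fourth roots matter; hence the congruence lemmas below.\<close>

definition from_coords :: "(complex \<Rightarrow> bool \<Rightarrow> bool \<Rightarrow> complex) \<Rightarrow> Q" where
  "from_coords c = (\<Sum>w\<in>fourth_roots. pbw_comb w (c w))"

lemma from_coords_coord: "from_coords (\<lambda>w p q. pbw_coord w p q x) = x"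
  unfolding from_coords_def by (rule pbw_expansion[symmetric])

lemma coord_from_coords: "w \<in> fourth_roots \<Longrightarrow> pbw_coord w p q (from_coords c) = c w p q"
  by (simp add: from_coords_def functional_simps[OF functional_pbw_coord] pbw_coord_pbw_comb
      fourth_roots_def cong: sum.cong_simp)

lemma from_coords_cong:
  "(\<And>w p q. w \<in> fourth_roots \<Longrightarrow> c w p q = d w p q) \<Longrightarrow> from_coords c = from_coords d"
  by (simp add: from_coords_def pbw_comb_def)

lemma from_coords_eqD: "from_coords c = from_coords d \<Longrightarrow> w \<in> fourth_roots \<Longrightarrow> c w p q = d w p q"
  using coord_from_coords by metis

definition dual_coords :: "Q dual \<Rightarrow> complex \<Rightarrow> bool \<Rightarrow> bool \<Rightarrow> complex" where
  "dual_coords f w p q = dual_apply f (pbw_word w p q)"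

lemma dual_apply_from_coords:
  "dual_apply f (from_coords c) =
    (\<Sum>w\<in>fourth_roots. \<Sum>p\<in>UNIV. \<Sum>q\<in>UNIV. c w p q * dual_coords f w p q)"
  by (simp add: from_coords_def pbw_comb_def functional_simps[OF functional_dual_apply]
      dual_coords_def pbw_word_def UNIV_bool add_ac)

lemma dual_eqI:
  assumes "\<And>w p q. w \<in> fourth_roots \<Longrightarrow> dual_coords f w p q = dual_coords g w p q"
  shows "f = g"
proof -
  have "dual_apply f x = dual_apply g x" for x
    using dual_apply_from_coords[of f "\<lambda>w p q. pbw_coord w p q x"]
      dual_apply_from_coords[of g "\<lambda>w p q. pbw_coord w p q x"] assms
    by (simp add: from_coords_coord)
  then show ?thesis by (simp add: dual_apply_inject[symmetric] fun_eq_iff)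
qed

lemma pbw_word_from_coords:
  "w \<in> fourth_roots \<Longrightarrow> pbw_word w p q = from_coords (\<lambda>w' p' q'. of_bool (w' = w \<and> p' = p \<and> q' = q))"
  by (cases p; cases q) (auto simp: fourth_roots_def from_coords_def sum_fourth_roots[unfolded fourth_roots_def]
       pbw_comb_def pbw_word_def fourth_roots_distinct scaleC_one)

lemma exists_dual_coords:
  obtains f where "\<And>w p q. w \<in> fourth_roots \<Longrightarrow> dual_coords f w p q = c w p q"
proof -
  define g where "g = (\<lambda>x. \<Sum>w\<in>fourth_roots. \<Sum>p\<in>UNIV. \<Sum>q\<in>UNIV. pbw_coord w p q x * c w p q)"
  have "functional g" unfolding g_def
    by (rule functionalI)
      (simp_all add: functional_simps[OF functional_pbw_coord] sum.distrib distrib_right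
        sum_distrib_left mult.assoc)
  then have g: "dual_apply (Abs_dual g) = g" by (simp add: Abs_dual_inverse)
  have "g (pbw_word w p q) = c w p q" if "w \<in> fourth_roots" for w p q
    using that
    by (cases p; cases q) (auto simp: g_def pbw_word_from_coords coord_from_coords UNIV_bool sum.distrib fourth_roots_def fourth_roots_distinct)
  with that[of "Abs_dual g"] g show thesis by (simp add: dual_coords_def)
qed

text \<open>Obtained by contracting the first factor in the four monodromy formulas:
  \<open>y\<close> pairs equal words, \<open>z\<close> pairs E with F, and \<open>x0\<close> comes
  from the summands \<open>K_idem a\<close> tensor EF \<open>K_idem b\<close>, present for odd
  \<open>a\<close> only.\<close>

definition drinfeld_coord ::
    "complex \<Rightarrow> (complex \<Rightarrow> bool \<Rightarrow> bool \<Rightarrow> complex) \<Rightarrow> complex \<Rightarrow> bool \<Rightarrow> bool \<Rightarrow> complex" where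
  "drinfeld_coord \<beta> x w p q = (let y = (\<lambda>w. x w p q); z = (\<lambda>w. x w q p); x0 = (\<lambda>w. x w False False) in
     if w \<in> {1, - 1} then
       (if p \<and> q then 4 * w * (y 1 - y (- 1)) + 4 * \<i> * (x0 \<i> + x0 (- \<i>) - y \<i> + y (- \<i>))
        else if p then 2 * (z \<i> - z (- \<i>)) - 2 * \<i> * w * (z 1 - z (- 1))
        else if q then 2 * \<i> * (z 1 + z (- 1)) - 2 * \<i> * w * (z \<i> + z (- \<i>))
        else y 1 + y (- 1) + w * (y \<i> + y (- \<i>)))
     else
       (if p \<and> q then 4 * w * (y 1 + y (- 1)) + 4 * \<beta>\<^sup>2 * (y \<i> + y (- \<i>) - x0 \<i> + x0 (- \<i>))
        else if p then 2 * \<i> * w * (z 1 + z (- 1)) - 2 * \<i> * \<beta>\<^sup>2 * (z \<i> + z (- \<i>))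
        else if q then 2 * \<beta>\<^sup>2 * w * (z \<i> - z (- \<i>)) - 2 * \<i> * (z 1 - z (- 1))
        else y 1 - y (- 1) - \<i> * \<beta>\<^sup>2 * w * (y \<i> - y (- \<i>))))"

lemma sum_sum_K_idem: "(\<Sum>a\<in>fourth_roots. \<Sum>b\<in>fourth_roots. K_idem a \<otimes> K_idem b) = 1"
proof -
  have "(\<Sum>a\<in>fourth_roots. \<Sum>b\<in>fourth_roots. K_idem a \<otimes> K_idem b)
    = (\<Sum>a\<in>fourth_roots. K_idem a) \<otimes> (\<Sum>a\<in>fourth_roots. K_idem a)"
    by (simp only: sum_fourth_roots pure_tensor_add_left pure_tensor_add_right add_ac)
  then show ?thesis by (simp add: sum_K_idem pure_tensor_one)
qed

lemma drinfeld_map_coords: "drinfeld_map \<beta> f = from_coords (drinfeld_coord \<beta> (dual_coords f))"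
proof (rule functionals_separate)
  fix g :: "Q \<Rightarrow> complex" assume g: "functional g"
  have "monodromy \<beta> = (\<Sum>a\<in>fourth_roots. \<Sum>b\<in>fourth_roots. monodromy \<beta> * (K_idem a \<otimes> K_idem b))"
    by (simp add: sum_sum_K_idem flip: sum_distrib_left)
  then have M: "drinfeld_map \<beta> f = tensor_contract f \<dots>" unfolding drinfeld_map_def by (rule arg_cong)
  show "g (drinfeld_map \<beta> f) = g (from_coords (drinfeld_coord \<beta> (dual_coords f)))"
    unfolding M sum_fourth_roots from_coords_def
    by (simp add: fourth_roots_distinct monodromy_even_even monodromy_even_odd monodromy_odd_even monodromy_odd_odd
       tensor_contract_simps tensor_contract_diff tensor_contract_uminus tensor_contract_scaleC functional_simps[OF g] pbw_comb_def)
     (simp add: drinfeld_coord_def dual_coords_def pbw_word_def fourth_roots_distinct algebra_simps)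
qed

text \<open>The coproduct puts each of the letters E and F into exactly one tensor factor, hence the
  negated \<open>p\<close> and \<open>q\<close>; the inverse of \<open>w\<close> comes from
  \<open>coproduct_K_idem_1\<close>.\<close>

definition radford_coord ::
    "complex \<Rightarrow> (complex \<Rightarrow> bool \<Rightarrow> bool \<Rightarrow> complex) \<Rightarrow> complex \<Rightarrow> bool \<Rightarrow> bool \<Rightarrow> complex" where
  "radford_coord \<beta> x w p q = - 4 * \<i> * \<beta>\<^sup>2 *
     (if p then (if q then w else 1) else if q then - (w ^ 2) else w) * x (inverse w) (\<not> p) (\<not> q)"

lemma cointegral_eq: "cointegral \<beta> = (- 4 * \<i> * \<beta>\<^sup>2) *\<^sub>C (E\<^sub>Q * F\<^sub>Q * K_idem 1)"
proof -
  have "(\<Sum>j = 0..3. K\<^sub>Q ^ j) = 4 *\<^sub>C K_idem 1"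
    by (simp add: K_idem_def scaleC_scaleC scaleC_one numeral_3_eq_3 power2_eq_square power3_eq_cube add_ac)
  then show ?thesis by (simp add: cointegral_def mult_scaleC_right scaleC_scaleC)
qed

text \<open>K tensor K has eigenvalue a*b on the projection for (a, b), and the left side is its
  projection for the eigenvalue 1.\<close>

lemma coproduct_K_idem_1: "coproduct (K_idem 1) = (\<Sum>w\<in>fourth_roots. K_idem w \<otimes> K_idem (inverse w))"
proof (rule functionals_separate)
  fix g :: "(Q, Q) tensor \<Rightarrow> complex" assume g: "functional g"
  show "g (coproduct (K_idem 1)) = g (\<Sum>w\<in>fourth_roots. K_idem w \<otimes> K_idem (inverse w))"
    unfolding sum_fourth_roots
    by (simp add: K_idem_def coproduct_hom coproduct_generators pure_tensor_mult functional_simps[OF g]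
     pure_tensor_add_left pure_tensor_add_right pure_tensor_scaleC_left pure_tensor_scaleC_right scaleC_one
     power2_eq_square power3_eq_cube pure_tensor_uminus pure_tensor_one algebra_simps pure_tensor_diff cvs.scale_right_distrib scaleC_scaleC)
qed

lemma radford_map_coords: "radford_map \<beta> f = from_coords (radford_coord \<beta> (dual_coords f))"
proof (rule functionals_separate)
  fix g :: "Q \<Rightarrow> complex" assume g: "functional g"
  show "g (radford_map \<beta> f) = g (from_coords (radford_coord \<beta> (dual_coords f)))"
    unfolding radford_map_def cointegral_eq coproduct_hom coproduct_generators coproduct_K_idem_1 sum_fourth_roots
    from_coords_def
    by (simp add: word_simps tensor_contract_simps tensor_contract_diff tensor_contract_uminus tensor_contract_scaleC functional_simps[OF g] pbw_comb_def
       Kinv_left Kinv_K_idem fourth_roots_def)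
     (simp add: radford_coord_def dual_coords_def pbw_word_def functional_simps[OF functional_dual_apply] algebra_simps power2_eq_square power3_eq_cube)
qed

text \<open>For fixed \<open>p\<close> and \<open>q\<close> the equations decouple into sums and
  differences over opposite roots, with normalisations 1/4, 1/8 and 1/16. The \<open>y0\<close> term
  undoes the coupling to \<open>x0\<close> by back substitution. Since \<beta>^4 = -1, the inverse
  of \<beta>^2 is -\<beta>^2, so no division by \<beta> occurs.\<close>

definition drinfeld_inverse ::
    "complex \<Rightarrow> (complex \<Rightarrow> bool \<Rightarrow> bool \<Rightarrow> complex) \<Rightarrow> complex \<Rightarrow> bool \<Rightarrow> bool \<Rightarrow> complex" where
  "drinfeld_inverse \<beta> y w p q = (let t = (\<lambda>w. y w p q); z = (\<lambda>w. y w q p); y0 = (\<lambda>w. y w False False) in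
     if w \<in> {1, - 1} then
       (if p \<and> q then (w * (t 1 - t (- 1)) - \<i> * (t \<i> - t (- \<i>))) / 16
        else if p then \<i> * (w * (z \<i> + z (- \<i>)) - (z 1 + z (- 1))) / 8
        else if q then (\<i> * w * (z 1 - z (- 1)) - (z \<i> - z (- \<i>))) / 8
        else (t 1 + t (- 1) + w * (t \<i> + t (- \<i>))) / 4)
     else
       (if p \<and> q then (w * (t 1 + t (- 1)) - \<beta>\<^sup>2 * (t \<i> + t (- \<i>))) / 16
            - (\<beta>\<^sup>2 * (y0 \<i> - y0 (- \<i>)) + \<i> * w * (y0 1 - y0 (- 1))) / 4
        else if p then (\<i> * (z 1 - z (- 1)) + \<beta>\<^sup>2 * w * (z \<i> - z (- \<i>))) / 8
        else if q then - (\<i> * \<beta>\<^sup>2 * (z \<i> + z (- \<i>)) + \<i> * w * (z 1 + z (- 1))) / 8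
        else (t 1 - t (- 1) + \<i> * \<beta>\<^sup>2 * w * (t \<i> - t (- \<i>))) / 4))"

lemma sq_mult_sq: "\<beta> ^ 4 = - 1 \<Longrightarrow> \<beta>\<^sup>2 * (\<beta>\<^sup>2 * x) = - (x :: complex)"
proof -
  assume "\<beta> ^ 4 = - 1"
  moreover have "\<beta>\<^sup>2 * (\<beta>\<^sup>2 * x) = \<beta> ^ 4 * x" by (simp add: power4_eq_xxxx power2_eq_square)
  ultimately show ?thesis by simp
qed

lemma fourth_rootsE:
  assumes "w \<in> fourth_roots"
  obtains "w = 1" | "w = \<i>" | "w = - 1" | "w = - \<i>"
  using assms by (auto simp: fourth_roots_def)

lemma drinfeld_coord_inverse:
  assumes "\<beta> ^ 4 = - 1" "w \<in> fourth_roots"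
  shows "drinfeld_coord \<beta> (drinfeld_inverse \<beta> y) w p q = y w p q"
  using assms(2)
  by (cases rule: fourth_rootsE; cases p; cases q)
    (simp_all add: drinfeld_coord_def drinfeld_inverse_def Let_def fourth_roots_distinct,
     simp_all add: field_simps sq_mult_sq[OF assms(1)] assms(1))

lemma drinfeld_inverse_coord:
  assumes "\<beta> ^ 4 = - 1" "w \<in> fourth_roots"
  shows "drinfeld_inverse \<beta> (drinfeld_coord \<beta> x) w p q = x w p q"
  using assms(2)
  by (cases rule: fourth_rootsE; cases p; cases q)
    (simp_all add: drinfeld_coord_def drinfeld_inverse_def Let_def fourth_roots_distinct,
     simp_all add: field_simps sq_mult_sq[OF assms(1)] assms(1))

lemma drinfeld_inverse_cong:
  assumes "\<And>w p q. w \<in> fourth_roots \<Longrightarrow> x w p q = y w p q"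
  shows "drinfeld_inverse \<beta> x w p q = drinfeld_inverse \<beta> y w p q"
  using assms by (simp add: drinfeld_inverse_def Let_def fourth_roots_def)

lemma drinfeld_coord_cong:
  assumes "\<And>w p q. w \<in> fourth_roots \<Longrightarrow> x w p q = y w p q"
  shows "drinfeld_coord \<beta> x w p q = drinfeld_coord \<beta> y w p q"
  using assms by (simp add: drinfeld_coord_def Let_def fourth_roots_def)

lemma dual_coords_drinfeld:
  assumes "\<beta> ^ 4 = - 1" "w \<in> fourth_roots" "drinfeld_map \<beta> f = from_coords c"
  shows "dual_coords f w p q = drinfeld_inverse \<beta> c w p q"
proof -
  have "drinfeld_coord \<beta> (dual_coords f) w p q = c w p q" if "w \<in> fourth_roots" for w p q
    using assms(3) that unfolding drinfeld_map_coords by (rule from_coords_eqD)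
  then have "drinfeld_inverse \<beta> (drinfeld_coord \<beta> (dual_coords f)) w p q = drinfeld_inverse \<beta> c w p q"
    by (rule drinfeld_inverse_cong)
  then show ?thesis by (simp add: drinfeld_inverse_coord[OF assms(1,2)])
qed

lemma bij_drinfeld_map:
  assumes "\<beta> ^ 4 = - 1"
  shows "bij (drinfeld_map \<beta>)"
proof (rule bijI)
  show "inj (drinfeld_map \<beta>)"
  proof (rule injI)
    fix f g assume eq: "drinfeld_map \<beta> f = drinfeld_map \<beta> g"
    have "drinfeld_map \<beta> f = from_coords (drinfeld_coord \<beta> (dual_coords g))"
      unfolding eq by (rule drinfeld_map_coords)
    from dual_coords_drinfeld[OF assms _ this] show "f = g"
      by (intro dual_eqI) (simp add: drinfeld_inverse_coord[OF assms])
  qed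
  show "surj (drinfeld_map \<beta>)"
  proof (rule surjI)
    fix x
    let ?c = "\<lambda>w p q. pbw_coord w p q x"
    obtain f where f: "\<And>w p q. w \<in> fourth_roots \<Longrightarrow> dual_coords f w p q = drinfeld_inverse \<beta> ?c w p q"
      using exists_dual_coords[of "drinfeld_inverse \<beta> ?c"] by blast
    have "drinfeld_map \<beta> f = from_coords (drinfeld_coord \<beta> (drinfeld_inverse \<beta> ?c))"
      unfolding drinfeld_map_coords by (intro from_coords_cong drinfeld_coord_cong f)
    also have "\<dots> = from_coords ?c"
      by (intro from_coords_cong drinfeld_coord_inverse assms)
    finally have "drinfeld_map \<beta> f = x" by (simp add: from_coords_coord)
    then show "drinfeld_map \<beta> (inv (drinfeld_map \<beta>) x) = x" by (metis f_inv_into_f rangeI)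
  qed
qed

lemma modular_S_from_coords:
  assumes "\<beta> ^ 4 = - 1"
  shows "modular_S \<beta> (from_coords c) = from_coords (radford_coord \<beta> (drinfeld_inverse \<beta> c))"
proof -
  let ?f = "inv (drinfeld_map \<beta>) (from_coords c)"
  have "drinfeld_map \<beta> ?f = from_coords c"
    using bij_drinfeld_map[OF assms] by (simp add: bij_is_surj surj_f_inv_f)
  from dual_coords_drinfeld[OF assms _ this]
  have "dual_coords ?f w p q = drinfeld_inverse \<beta> c w p q" if "w \<in> fourth_roots" for w p q
    using that by blast
  then show ?thesis unfolding modular_S_def radford_map_coords
    by (intro from_coords_cong) (auto simp: radford_coord_def fourth_roots_def)
qed

section \<open>The centre\<close>

text \<open>The coordinate vectors correspond to \<open>\<rho> = e\<^sub>0\<close>, \<open>\<phi> = 2\<beta>\<^sup>2 (w\<^sup>+ - w\<^sup>-)\<close>,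
  \<open>\<kappa>\<^sub>1 = e\<^sub>1 / 2\<close> and \<open>(e\<^sub>1\<^sup>+ - e\<^sub>1\<^sup>-) / 2 \<plusminus> \<i>\<beta>\<^sup>2 (w\<^sup>+ + w\<^sup>-)\<close>, with the upper sign for \<open>\<kappa>\<^sub>0\<close> and
  the lower one for \<open>\<kappa>\<^sub>2\<close>.\<close>

definition central_coord :: "complex \<Rightarrow> fgst \<Rightarrow> complex \<Rightarrow> bool \<Rightarrow> bool \<Rightarrow> complex" where
  "central_coord \<beta> v w p q =
    (if p \<noteq> q then 0
     else if w \<in> {1, - 1} then
       (if p then 2 * \<beta>\<^sup>2 * w * v $ Phi1 - \<i> * \<beta>\<^sup>2 * (v $ Kappa2 - v $ Kappa0) else v $ Rho1)
     else if p then v $ Kappa0 + v $ Kappa2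
     else (v $ Kappa1 + \<i> * w * (v $ Kappa0 + v $ Kappa2)) / 2)"

definition central_iso :: "complex \<Rightarrow> fgst \<Rightarrow> Q" where
  "central_iso \<beta> v = from_coords (central_coord \<beta> v)"

text \<open>This acts on coordinates, so its rows are the columns of the formulas for basis vectors,
  which \<open>S_coord_basis\<close> recovers.\<close>

definition S_coord :: "fgst \<Rightarrow> fgst" where
  "S_coord v = (\<chi> i. case i of Rho1 \<Rightarrow> \<i> * v $ Phi1 | Phi1 \<Rightarrow> - \<i> * v $ Rho1
    | Kappa0 \<Rightarrow> (v $ Kappa0 - v $ Kappa1 + v $ Kappa2) / 2
    | Kappa1 \<Rightarrow> v $ Kappa2 - v $ Kappa0
    | Kappa2 \<Rightarrow> (v $ Kappa0 + v $ Kappa1 + v $ Kappa2) / 2)"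

definition ribbon_coord :: "complex \<Rightarrow> fgst \<Rightarrow> fgst" where
  "ribbon_coord \<beta> v = (\<chi> i. case i of Rho1 \<Rightarrow> v $ Rho1 | Phi1 \<Rightarrow> v $ Phi1 + (\<i> / \<beta>\<^sup>2) * v $ Rho1
    | Kappa0 \<Rightarrow> (\<beta> * v $ Kappa1 - v $ Kappa2 + v $ Kappa0) / 2
    | Kappa1 \<Rightarrow> \<beta> * (v $ Kappa0 + v $ Kappa2)
    | Kappa2 \<Rightarrow> (\<beta> * v $ Kappa1 + v $ Kappa2 - v $ Kappa0) / 2)"

definition T_coord :: "complex \<Rightarrow> complex \<Rightarrow> fgst \<Rightarrow> fgst" where
  "T_coord \<beta> b v = (\<chi> i. case i of Rho1 \<Rightarrow> b * (v $ Rho1 - (\<i> / \<beta>\<^sup>2) * v $ Phi1) | Phi1 \<Rightarrow> b * v $ Phi1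
    | Kappa0 \<Rightarrow> - b * \<beta> * v $ Kappa0
    | Kappa1 \<Rightarrow> b * v $ Kappa1
    | Kappa2 \<Rightarrow> b * \<beta> * v $ Kappa2)"

lemma all_fgst_index: "(\<forall>i. P i) \<longleftrightarrow> P Rho1 \<and> P Phi1 \<and> P Kappa0 \<and> P Kappa1 \<and> P Kappa2"
  by (auto intro: fgst_index.induct[of P])

lemma fgst_eq_iff: "v = w \<longleftrightarrow> v $ Rho1 = w $ Rho1 \<and> v $ Phi1 = w $ Phi1 \<and>
    v $ Kappa0 = w $ Kappa0 \<and> v $ Kappa1 = w $ Kappa1 \<and> v $ Kappa2 = w $ (Kappa2 :: fgst_index)"
  by (simp only: vec_eq_iff all_fgst_index)

lemma inverse_sq: "\<beta> ^ 4 = - 1 \<Longrightarrow> x / \<beta>\<^sup>2 = - (\<beta>\<^sup>2 * x :: complex)"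
proof -
  assume \<beta>: "\<beta> ^ 4 = - 1"
  then have "\<beta> \<noteq> 0" by auto
  moreover have "x = - (\<beta>\<^sup>2 * (\<beta>\<^sup>2 * x))" using sq_mult_sq[OF \<beta>] by simp
  ultimately show "x / \<beta>\<^sup>2 = - (\<beta>\<^sup>2 * x)" by (simp add: divide_eq_eq mult.commute mult.left_commute)
qed

lemma modular_S_central_iso:
  assumes "\<beta> ^ 4 = - 1"
  shows "modular_S \<beta> (central_iso \<beta> v) = central_iso \<beta> (S_coord v)"
  unfolding central_iso_def modular_S_from_coords[OF assms]
proof (rule from_coords_cong)
  fix w p q assume "w \<in> fourth_roots"
  then show "radford_coord \<beta> (drinfeld_inverse \<beta> (central_coord \<beta> v)) w p q = central_coord \<beta> (S_coord v) w p q"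
    by (cases rule: fourth_rootsE; cases p; cases q)
      (simp_all add: radford_coord_def drinfeld_inverse_def central_coord_def S_coord_def Let_def fourth_roots_distinct,
       simp_all add: field_simps sq_mult_sq[OF assms(1)] assms(1))
qed

section \<open>Multiplication by the ribbon element\<close>

lemma ribbon_even:
  assumes a: "a \<in> {1, - 1}"
  shows "ribbon \<beta> * K_idem a = K_idem a + (2 * \<i> * a) *\<^sub>C (E\<^sub>Q * (F\<^sub>Q * K_idem a))"
proof (rule functionals_separate)
  fix g :: "Q \<Rightarrow> complex" assume g: "functional g"
  show "g (ribbon \<beta> * K_idem a) = g (K_idem a + (2 * \<i> * a) *\<^sub>C (E\<^sub>Q * (F\<^sub>Q * K_idem a)))"
    by (simp add: ribbon_def e1_plus_def e1_minus_def w_plus_def w_minus_def word_simps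
        even_root[OF a] functional_simps[OF g])
qed

text \<open>On odd projections the ribbon element is 2 \<beta> C, and straightening FE gives C = EF
  + (i/2) a on \<open>K_idem a\<close>.\<close>

lemma ribbon_odd:
  assumes a: "a \<in> {\<i>, - \<i>}"
  shows "ribbon \<beta> * K_idem a = (\<i> * \<beta> * a) *\<^sub>C K_idem a + (2 * \<beta>) *\<^sub>C (E\<^sub>Q * (F\<^sub>Q * K_idem a))"
proof (rule functionals_separate)
  fix g :: "Q \<Rightarrow> complex" assume g: "functional g"
  have "a ^ 3 = - a" by (simp add: power3_eq_cube odd_root[OF a])
  then show "g (ribbon \<beta> * K_idem a)
    = g ((\<i> * \<beta> * a) *\<^sub>C K_idem a + (2 * \<beta>) *\<^sub>C (E\<^sub>Q * (F\<^sub>Q * K_idem a)))"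
    by (simp add: ribbon_def e1_plus_def e1_minus_def w_plus_def w_minus_def casimir_def word_simps
        odd_root[OF a] F_E_K_idem Kinv_K_idem functional_simps[OF g] field_simps)
qed

lemma K_idem_E_F: "E\<^sub>Q * (F\<^sub>Q * K_idem a) = K_idem a * (E\<^sub>Q * F\<^sub>Q)"
  by (simp add: K_idem_word)

lemma ribbon_E_F:
  assumes a: "a \<in> fourth_roots"
  shows "ribbon \<beta> * (E\<^sub>Q * (F\<^sub>Q * K_idem a)) =
    (if a \<in> {1, - 1} then 1 else - \<i> * \<beta> * a) *\<^sub>C (E\<^sub>Q * (F\<^sub>Q * K_idem a))"
proof (rule functionals_separate)
  fix g :: "Q \<Rightarrow> complex" assume g: "functional g"
  have *: "ribbon \<beta> * (E\<^sub>Q * (F\<^sub>Q * K_idem a)) = (ribbon \<beta> * K_idem a) * (E\<^sub>Q * F\<^sub>Q)"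
    by (simp only: K_idem_E_F mult.assoc)
  have "a \<in> {1, - 1} \<or> a \<in> {\<i>, - \<i>}" using a by (auto simp: fourth_roots_def)
  then show "g (ribbon \<beta> * (E\<^sub>Q * (F\<^sub>Q * K_idem a))) =
    g ((if a \<in> {1, - 1} then 1 else - \<i> * \<beta> * a) *\<^sub>C (E\<^sub>Q * (F\<^sub>Q * K_idem a)))"
  proof (elim disjE)
    assume "a \<in> {1, - 1}"
    then have "ribbon \<beta> * (E\<^sub>Q * (F\<^sub>Q * K_idem a))
      = (K_idem a + (2 * \<i> * a) *\<^sub>C (E\<^sub>Q * (F\<^sub>Q * K_idem a))) * (E\<^sub>Q * F\<^sub>Q)"
      by (simp only: * ribbon_even)
    with \<open>a \<in> {1, - 1}\<close> show ?thesis
      by (simp add: word_simps K_idem_word F_E_F_K_idem even_root scaleC_one E_E_left)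
  next
    assume a: "a \<in> {\<i>, - \<i>}"
    then have "a \<notin> {1, - 1}" by (auto simp: complex_eq_iff)
    moreover have "ribbon \<beta> * (E\<^sub>Q * (F\<^sub>Q * K_idem a))
      = ((\<i> * \<beta> * a) *\<^sub>C K_idem a + (2 * \<beta>) *\<^sub>C (E\<^sub>Q * (F\<^sub>Q * K_idem a))) * (E\<^sub>Q * F\<^sub>Q)"
      using a by (simp only: * ribbon_odd)
    ultimately show ?thesis
      by (simp add: word_simps K_idem_word F_E_F_K_idem odd_root[OF a] functional_simps[OF g])
  qed
qed

lemma ribbon_central_iso:
  assumes "\<beta> ^ 4 = - 1"
  shows "ribbon \<beta> * central_iso \<beta> v = central_iso \<beta> (ribbon_coord \<beta> v)"
proof (rule functionals_separate)
  fix g :: "Q \<Rightarrow> complex" assume g: "functional g"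
  have "1 \<in> fourth_roots" "\<i> \<in> fourth_roots" "- 1 \<in> fourth_roots" "- \<i> \<in> fourth_roots"
    by (simp_all add: fourth_roots_def)
  then show "g (ribbon \<beta> * central_iso \<beta> v) = g (central_iso \<beta> (ribbon_coord \<beta> v))"
    unfolding central_iso_def from_coords_def sum_fourth_roots
    by (simp add: pbw_comb_def central_coord_def ribbon_coord_def distrib_left mult_scaleC_right
      ribbon_even ribbon_odd ribbon_E_F functional_simps[OF g] fourth_roots_distinct inverse_sq[OF assms],
      simp add: field_simps assms)
qed

section \<open>Determination of the centre\<close>

lemma centreI:
  assumes "z * E\<^sub>Q = E\<^sub>Q * z" "z * F\<^sub>Q = F\<^sub>Q * z" "z * K\<^sub>Q = K\<^sub>Q * z"
  shows "z \<in> centre"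
proof -
  have "z * x = x * z" for x
  proof (induction x rule: Q_induct)
    case Kinv
    show ?case using assms(3) by (simp add: Kinv_eq power_commuting_commutes)
  next
    case (mult x y)
    then show ?case by (metis mult.assoc)
  qed (use assms in \<open>simp_all add: mult_scaleC_left mult_scaleC_right distrib_left distrib_right\<close>)
  then show ?thesis by (simp add: centre_def)
qed

lemma fourth_roots_mem: "1 \<in> fourth_roots" "\<i> \<in> fourth_roots" "- 1 \<in> fourth_roots" "- \<i> \<in> fourth_roots"
  by (simp_all add: fourth_roots_def)

lemma from_coords_mult_K:
  "from_coords c * K\<^sub>Q = from_coords (\<lambda>w p q. w * c w p q)"
  "K\<^sub>Q * from_coords c = from_coords (\<lambda>w p q. (if p = q then w else - w) * c w p q)"
  by (simp_all add: from_coords_def sum_fourth_roots pbw_comb_def distrib_left distrib_right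
      mult_scaleC_left mult_scaleC_right mult.assoc K_idem_K K_left K_K_idem fourth_roots_mem scaleC_scaleC
      mult.commute)

lemma from_coords_mult_E:
  "from_coords c * E\<^sub>Q = from_coords (\<lambda>w p q. if p then (if q then c (- w) False True
       else c (- w) False False - K_weight w * c (- w) True True)
     else if q then 0 else - K_weight w * c (- w) False True)" (is "?l = ?r")
  "E\<^sub>Q * from_coords c = from_coords (\<lambda>w p q. if p then c w False q else 0)"
proof -
  show "?l = ?r"
  proof (rule functionals_separate)
    fix g :: "Q \<Rightarrow> complex" assume g: "functional g"
    show "g ?l = g ?r"
      by (simp add: from_coords_def sum_fourth_roots pbw_comb_def distrib_left distrib_right
          mult_scaleC_left mult_scaleC_right mult.assoc K_idem_word F_E_K_idem fourth_roots_mem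
          E_E_left right_diff_distrib functional_simps[OF g] K_weight_uminus, simp add: algebra_simps)
  qed
qed (simp add: from_coords_def sum_fourth_roots pbw_comb_def distrib_left mult_scaleC_right E_E_left)

lemma from_coords_mult_F:
  "from_coords c * F\<^sub>Q = from_coords (\<lambda>w p q. if q then c (- w) p False else 0)"
  "F\<^sub>Q * from_coords c = from_coords (\<lambda>w p q. if q then (if p then c w True False
       else c w False False + K_weight w * c w True True)
     else if p then 0 else - K_weight w * c w True False)" (is "?l = ?r")
proof -
  show "?l = ?r"
  proof (rule functionals_separate)
    fix g :: "Q \<Rightarrow> complex" assume g: "functional g"
    show "g ?l = g ?r"
      by (simp add: from_coords_def sum_fourth_roots pbw_comb_def distrib_left distrib_right
          mult_scaleC_left mult_scaleC_right mult.assoc F_E_K_idem F_E_F_K_idem fourth_roots_mem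
          F_F_left functional_simps[OF g], simp add: algebra_simps)
  qed
qed (simp add: from_coords_def sum_fourth_roots pbw_comb_def distrib_right mult_scaleC_left
    mult.assoc K_idem_word F_F_left add_ac)

lemma K_weight_values: "K_weight 1 = 0" "K_weight (- 1) = 0" "K_weight \<i> = 1" "K_weight (- \<i>) = - 1"
  by (simp_all add: K_weight_def power3_eq_cube)

lemma central_iso_in_centre: "central_iso \<beta> v \<in> centre"
proof (rule centreI)
  show "central_iso \<beta> v * E\<^sub>Q = E\<^sub>Q * central_iso \<beta> v" "central_iso \<beta> v * F\<^sub>Q = F\<^sub>Q * central_iso \<beta> v"
    "central_iso \<beta> v * K\<^sub>Q = K\<^sub>Q * central_iso \<beta> v"
    unfolding central_iso_def from_coords_mult_E from_coords_mult_F from_coords_mult_K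
    by (intro from_coords_cong; elim fourth_rootsE;
        simp add: central_coord_def K_weight_values fourth_roots_distinct field_simps)+
qed

text \<open>Solves \<open>central_coord\<close> for the vector, with 1/\<beta>^2 again written as
  -\<beta>^2.\<close>

definition central_inverse :: "complex \<Rightarrow> (complex \<Rightarrow> bool \<Rightarrow> bool \<Rightarrow> complex) \<Rightarrow> fgst" where
  "central_inverse \<beta> c = (let t = (\<lambda>w. c w True True); x = (\<lambda>w. c w False False) in
     \<chi> i. case i of Rho1 \<Rightarrow> x 1 | Phi1 \<Rightarrow> - \<beta>\<^sup>2 * (t 1 - t (- 1)) / 4
     | Kappa0 \<Rightarrow> t \<i> / 2 + \<i> * \<beta>\<^sup>2 * (t 1 + t (- 1)) / 4
     | Kappa1 \<Rightarrow> x \<i> + x (- \<i>)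
     | Kappa2 \<Rightarrow> t \<i> / 2 - \<i> * \<beta>\<^sup>2 * (t 1 + t (- 1)) / 4)"

lemma central_inverse_coord:
  assumes "\<beta> ^ 4 = - 1"
  shows "central_inverse \<beta> (central_coord \<beta> v) = v"
  by (simp add: fgst_eq_iff central_inverse_def central_coord_def Let_def fourth_roots_distinct,
     simp add: field_simps sq_mult_sq[OF assms] assms)

text \<open>Commuting with K removes the words E and F, commuting with E gives \<open>rel\<close>.
  Five coordinates stay free: one scalar on the even part, two coefficients of EF there, and two
  scalars on the odd part.\<close>

lemma centre_eq_range:
  assumes "\<beta> ^ 4 = - 1"
  shows "range (central_iso \<beta>) = centre"
proof
  show "centre \<subseteq> range (central_iso \<beta>)"
  proof
    fix z :: Q assume z: "z \<in> centre"
    define c where "c = (\<lambda>w p q. pbw_coord w p q z)"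
    have zc: "z = from_coords c" by (simp add: c_def from_coords_coord)
    have "from_coords c * x = x * from_coords c" for x using z by (simp add: zc centre_def)
    note K = from_coords_eqD[OF this[of "K\<^sub>Q", unfolded from_coords_mult_K]]
      and E = from_coords_eqD[OF this[of "E\<^sub>Q", unfolded from_coords_mult_E]]
    \<comment> \<open>On these words K acts by -w from the left and by w from the right.\<close>
    have 0: "c w p (\<not> p) = 0" if "w \<in> fourth_roots" for w p
      using K[OF that, of p "\<not> p"] that by (auto simp: fourth_roots_def)
    \<comment> \<open>This compares the coefficients of E \<open>K_idem w\<close>; the values w = 1,
      i, -i then yield \<open>rel\<close>.\<close>
    have E: "c (- w) False False - K_weight w * c (- w) True True = c w False False"
      if "w \<in> fourth_roots" for w
      using E[OF that, of True False] by simp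
    have rel: "c (- 1) False False = c 1 False False"
      "c \<i> True True = c (- \<i>) False False - c \<i> False False"
      "c (- \<i>) True True = c (- \<i>) False False - c \<i> False False"
      using E[of 1] E[of \<i>] E[of "- \<i>"] by (simp_all add: fourth_roots_def K_weight_values algebra_simps)
    have "z = central_iso \<beta> (central_inverse \<beta> c)"
      unfolding zc central_iso_def
    proof (rule from_coords_cong)
      fix w p q assume "w \<in> fourth_roots"
      with 0[of w p] rel show "c w p q = central_coord \<beta> (central_inverse \<beta> c) w p q"
        by (elim fourth_rootsE; cases "p = q"; cases p)
          (simp_all add: central_coord_def central_inverse_def Let_def fourth_roots_distinct,
           simp_all add: field_simps sq_mult_sq[OF assms] assms)
    qed
    then show "z \<in> range (central_iso \<beta>)" by blast
  qed
qed (auto simp: central_iso_in_centre)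

lemma inj_central_iso:
  assumes "\<beta> ^ 4 = - 1"
  shows "inj (central_iso \<beta>)"
proof (rule injI)
  fix v w assume "central_iso \<beta> v = central_iso \<beta> w"
  then have "central_coord \<beta> v u p q = central_coord \<beta> w u p q" if "u \<in> fourth_roots" for u p q
    using that unfolding central_iso_def by (rule from_coords_eqD)
  then have "central_inverse \<beta> (central_coord \<beta> v) = central_inverse \<beta> (central_coord \<beta> w)"
    by (simp add: central_inverse_def Let_def fourth_roots_def)
  then show "v = w" by (simp add: central_inverse_coord[OF assms])
qed

lemma central_iso_linear:
  "central_iso \<beta> (v + w) = central_iso \<beta> v + central_iso \<beta> w"
  "central_iso \<beta> (c *s v) = c *\<^sub>C central_iso \<beta> v"
proof -
  have "from_coords (\<lambda>w p q. x w p q + y w p q) = from_coords x + from_coords y" for x y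
    by (simp add: from_coords_def sum_fourth_roots pbw_comb_def scaleC_add_left add_ac)
  moreover have "from_coords (\<lambda>w p q. c * x w p q) = c *\<^sub>C from_coords x" for x
    by (simp add: from_coords_def sum_fourth_roots pbw_comb_def scaleC_add_right scaleC_scaleC)
  moreover have "central_coord \<beta> (v + w) = (\<lambda>u p q. central_coord \<beta> v u p q + central_coord \<beta> w u p q)"
    "central_coord \<beta> (c *s v) = (\<lambda>u p q. c * central_coord \<beta> v u p q)"
    by (auto simp: fun_eq_iff central_coord_def field_simps)
  ultimately show "central_iso \<beta> (v + w) = central_iso \<beta> v + central_iso \<beta> w"
    "central_iso \<beta> (c *s v) = c *\<^sub>C central_iso \<beta> v"
    by (simp_all add: central_iso_def)
qed

section \<open>The modular relations in coordinates\<close>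

lemma S_coord_S_coord: "S_coord (S_coord v) = v"
  by (simp add: fgst_eq_iff S_coord_def field_simps)

lemma S_coord_linear:
  "S_coord (v + w) = S_coord v + S_coord w" "S_coord (c *s v) = c *s S_coord v"
  by (simp_all add: fgst_eq_iff S_coord_def field_simps)

lemma T_coord_linear:
  "T_coord \<beta> b (v + w) = T_coord \<beta> b v + T_coord \<beta> b w" "T_coord \<beta> b (c *s v) = c *s T_coord \<beta> b v"
  by (simp_all add: fgst_eq_iff T_coord_def algebra_simps add_divide_distrib)

lemma T_coord_eq:
  assumes "\<beta> ^ 4 = - 1"
  shows "T_coord \<beta> b v = b *s S_coord (ribbon_coord \<beta> (S_coord v))"
  by (simp add: fgst_eq_iff T_coord_def ribbon_coord_def S_coord_def inverse_sq[OF assms] field_simps)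

lemma modular_T_central_iso:
  assumes "\<beta> ^ 4 = - 1"
  shows "modular_T \<beta> (central_iso \<beta> v) = central_iso \<beta> (T_coord \<beta> (bcoeff \<beta>) v)"
proof -
  \<comment> \<open>Injectivity makes \<open>inv_into\<close> evaluate on S-images; the argument of
    the inverse is then recognised as such an image because S is an involution.\<close>
  have "inj_on (modular_S \<beta>) centre"
    by (rule inj_on_inverseI[where g = "modular_S \<beta>"])
      (auto simp: modular_S_central_iso[OF assms] S_coord_S_coord simp flip: centre_eq_range[OF assms])
  from inv_into_f_f[OF this central_iso_in_centre, of \<beta> "S_coord (ribbon_coord \<beta> (S_coord v))"]
  show ?thesis
    by (simp add: modular_T_def modular_S_central_iso[OF assms] ribbon_central_iso[OF assms] S_coord_S_coord
        T_coord_eq[OF assms] central_iso_linear)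
qed

text \<open>\<open>T_coord\<close> is proportional to \<open>b\<close>, so the cube is b^3 times its
  value at b = 1, which is the scalar \<beta>^2. The condition on \<open>b\<close> is exactly what
  cancels this scalar.\<close>

lemma S_T_coord_cube:
  assumes "\<beta> ^ 4 = - 1" "b ^ 3 = - \<beta>\<^sup>2"
  shows "S_coord (T_coord \<beta> b (S_coord (T_coord \<beta> b (S_coord (T_coord \<beta> b v))))) = v"
proof -
  have b: "b * (b * b) = - (\<beta> * \<beta>)" "b * (b * (b * x)) = - (\<beta> * (\<beta> * x))" for x
    using assms(2) by (simp_all add: power3_eq_cube power2_eq_square flip: mult.assoc)
  have \<beta>: "\<beta> * (\<beta> * (\<beta> * \<beta>)) = - 1" "\<beta> * (\<beta> * (\<beta> * (\<beta> * x))) = - x" for x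
    using assms(1) by (simp_all add: power4_eq_xxxx flip: mult.assoc)
  have "\<beta> \<noteq> 0" using assms(1) by auto
  then show ?thesis
    by (simp add: fgst_eq_iff T_coord_def S_coord_def inverse_sq[OF assms(1)] power2_eq_square)
      (simp add: algebra_simps add_divide_distrib diff_divide_distrib b \<beta>)
qed

section \<open>The representation of the modular group on the centre\<close>

definition T_inv_coord :: "complex \<Rightarrow> complex \<Rightarrow> fgst \<Rightarrow> fgst" where
  "T_inv_coord \<beta> b v = (\<chi> i. case i of Rho1 \<Rightarrow> (v $ Rho1 + (\<i> / \<beta>\<^sup>2) * v $ Phi1) / b | Phi1 \<Rightarrow> v $ Phi1 / b
    | Kappa0 \<Rightarrow> - (v $ Kappa0 / (b * \<beta>))
    | Kappa1 \<Rightarrow> v $ Kappa1 / b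
    | Kappa2 \<Rightarrow> v $ Kappa2 / (b * \<beta>))"

lemma T_inv_coord_linear:
  "T_inv_coord \<beta> b (v + w) = T_inv_coord \<beta> b v + T_inv_coord \<beta> b w" "T_inv_coord \<beta> b (c *s v) = c *s T_inv_coord \<beta> b v"
  by (simp_all add: fgst_eq_iff T_inv_coord_def algebra_simps add_divide_distrib)

lemma T_coord_inverse:
  assumes "\<beta> \<noteq> 0" "b \<noteq> 0"
  shows "T_coord \<beta> b (T_inv_coord \<beta> b v) = v" "T_inv_coord \<beta> b (T_coord \<beta> b v) = v"
  using assms by (simp_all add: fgst_eq_iff T_inv_coord_def T_coord_def field_simps)

lemma SL2Z_rep_transport:
  assumes "SL2Z_rep sv U act" "vector_space sw" "inj f"
    and "\<And>u v. f (u + v) = f u + f v" "\<And>c v. f (sv c v) = sw c (f v)"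
  shows "SL2Z_rep sw (f ` U) (\<lambda>g z. f (act g (inv f z)))"
proof -
  interpret v: vector_space sv using assms(1) by (simp add: SL2Z_rep_def)
  interpret w: vector_space sw by (rule assms)
  have U: "0 \<in> U" "\<And>u v. u \<in> U \<Longrightarrow> v \<in> U \<Longrightarrow> u + v \<in> U" "\<And>c u. u \<in> U \<Longrightarrow> sv c u \<in> U"
    using assms(1) by (auto simp: SL2Z_rep_def v.subspace_def)
  have "f 0 = 0" using assms(4)[of 0 0] by simp
  then have "w.subspace (f ` U)"
    using U by (force simp: w.subspace_def simp flip: assms(4,5))
  then show ?thesis
    using assms(1) U by (auto simp: SL2Z_rep_def linear_between_def inv_f_f[OF assms(3)] w.vector_space_axioms
        simp flip: assms(4,5))
qed

lemma S_coord_basis: "S_coord (fgst_basis i) = fgst_S_basis i"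
  by (cases i) (simp_all add: fgst_eq_iff S_coord_def axis_def)

text \<open>Here \<beta>^2 = -i, so -i/\<beta>^2 = 1. The exponents, in units of i pi, add up to
  -1/2 + 2/3 = 1/6 for \<open>b\<close> and 1/6 - 1/4 = -1/12 for b \<beta>.\<close>

lemma T_coord_basis:
  assumes "\<beta> = exp (- \<i> * complex_of_real pi / 4)"
  shows "T_coord \<beta> (bcoeff \<beta>) (fgst_basis i) = fgst_T_basis i"
proof -
  have \<beta>2: "\<beta>\<^sup>2 = - \<i>"
  proof -
    have "\<beta>\<^sup>2 = exp (- (of_real pi / 2 * \<i>))"
      unfolding assms by (simp add: power2_eq_square mult_ac flip: exp_add)
    then show ?thesis by (simp add: complex_eq_iff Re_exp Im_exp)
  qed
  have b: "bcoeff \<beta> = exp (\<i> * of_real pi / 6)"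
    unfolding bcoeff_def assms power2_eq_square exp_add[symmetric] by (rule arg_cong[where f = exp]) (simp add: field_simps)
  have "bcoeff \<beta> * \<beta> = exp (- \<i> * of_real pi / 12)"
    unfolding b unfolding assms exp_add[symmetric] by (rule arg_cong[where f = exp]) (simp add: field_simps)
  with b \<beta>2 show ?thesis
    by (cases i) (simp_all add: fgst_eq_iff T_coord_def axis_def)
qed

text \<open>\<beta>^6 = -\<beta>^2, and the exponential factor is a cube root of unity; among these
  roots it is the one that matches the FGST value exp(i pi/6).\<close>

lemma bcoeff_cube:
  assumes "\<beta> ^ 4 = - 1"
  shows "bcoeff \<beta> ^ 3 = - \<beta>\<^sup>2" "bcoeff \<beta> \<noteq> 0"
proof -
  have "exp (2 * complex_of_real pi * \<i> / 3) ^ 3 = exp (of_nat 3 * (2 * complex_of_real pi * \<i> / 3))"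
    by (rule exp_of_nat_mult[symmetric])
  also have "\<dots> = exp (2 * of_real pi * \<i>)" by (rule arg_cong[where f = exp]) simp
  also have "\<dots> = 1" by (rule exp_two_pi_i)
  finally have "exp (2 * complex_of_real pi * \<i> / 3) ^ 3 = 1" .
  moreover have "(\<beta>\<^sup>2) ^ 3 = - \<beta>\<^sup>2"
    using sq_mult_sq[OF assms, of "\<beta>\<^sup>2"] by (simp add: power3_eq_cube mult.assoc)
  ultimately show "bcoeff \<beta> ^ 3 = - \<beta>\<^sup>2" by (simp add: bcoeff_def power_mult_distrib)
  show "bcoeff \<beta> \<noteq> 0" using assms by (auto simp: bcoeff_def)
qed

lemma exists_fgst_action:
  assumes \<beta>: "\<beta> ^ 4 = - 1"
  obtains act where
    "\<And>v. act S_mat v = S_coord v" "\<And>v. act T_mat v = T_coord \<beta> (bcoeff \<beta>) v"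
    "SL2Z_rep (*s) UNIV act"
    "SL2Z_rep (*s) {v. v $ Kappa0 = 0 \<and> v $ Kappa1 = 0 \<and> v $ Kappa2 = 0} act"
    "SL2Z_rep (*s) {v. v $ Rho1 = 0 \<and> v $ Phi1 = 0} act"
proof -
  let ?t = "T_coord \<beta> (bcoeff \<beta>)" and ?t' = "T_inv_coord \<beta> (bcoeff \<beta>)"
  have "\<beta> \<noteq> 0" using \<beta> by auto
  note inverse = T_coord_inverse[OF this bcoeff_cube(2)[OF \<beta>]]
  obtain act :: "int^2^2 \<Rightarrow> fgst \<Rightarrow> fgst" where act:
    "act (mat 1) = id" "act S_mat = S_coord" "act T_mat = ?t"
    "\<And>g h. g \<in> SL2Z \<Longrightarrow> h \<in> SL2Z \<Longrightarrow> act (g ** h) = act g \<circ> act h"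
    "\<And>P g. P id \<Longrightarrow> (\<And>f. P f \<Longrightarrow> P (S_coord \<circ> f)) \<Longrightarrow> (\<And>f. P f \<Longrightarrow> P (?t \<circ> f)) \<Longrightarrow>
      (\<And>f. P f \<Longrightarrow> P (?t' \<circ> f)) \<Longrightarrow> P (act g)"
    by (rule exists_PSL2Z_action[of S_coord ?t ?t'])
      (auto simp: fun_eq_iff S_coord_S_coord inverse S_T_coord_cube[OF \<beta> bcoeff_cube(1)[OF \<beta>]])
  \<comment> \<open>Linearity is taken as the predicate in the closure clause; below, the same
    clause yields invariance of a subspace, which requires invariance under \<open>?t'\<close>
    too.\<close>
  have linear: "act g (u + v) = act g u + act g v" "act g (c *s v) = c *s act g v" for g u v c
    using act(5)[where P = "\<lambda>f. (\<forall>u v. f (u + v) = f u + f v) \<and> (\<forall>c v. f (c *s v) = c *s f v)"]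
    by (auto simp: S_coord_linear T_coord_linear T_inv_coord_linear)
  have rep: "SL2Z_rep (*s) U act"
    if "vec.subspace U" "\<And>v. v \<in> U \<Longrightarrow> S_coord v \<in> U" "\<And>v. v \<in> U \<Longrightarrow> ?t v \<in> U" "\<And>v. v \<in> U \<Longrightarrow> ?t' v \<in> U" for U
  proof -
    have "\<forall>v\<in>U. act g v \<in> U" for g
      by (rule act(5)) (auto intro: that)
    then show ?thesis
      using that(1) vec.vector_space_axioms by (auto simp: SL2Z_rep_def linear_between_def linear act(1,4))
  qed
  show thesis
    by (rule that[of act]; (rule rep)?)
      (auto simp: act vec.subspace_def S_coord_def T_coord_def T_inv_coord_def)
qed

section \<open>Bases of the two summands\<close>

lemma basis_of_coordinate_subspace:
  assumes "distinct is"
  shows "basis_of (*s) {v :: fgst. \<forall>i. i \<notin> set is \<longrightarrow> v $ i = 0} (map fgst_basis is)" (is "basis_of _ ?U _")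
proof -
  have "fgst_basis ` set is \<subseteq> cart_basis" by (auto simp: cart_basis_def)
  then have "vec.independent (fgst_basis ` set is)"
    using vec.independent_mono independent_cart_basis by blast
  moreover have "vec.span (fgst_basis ` set is) = ?U"
  proof
    have "vec.subspace ?U" by (auto simp: vec.subspace_def)
    then show "vec.span (fgst_basis ` set is) \<subseteq> ?U"
      by (intro vec.span_minimal) (auto simp: axis_def)
    show "?U \<subseteq> vec.span (fgst_basis ` set is)"
    proof
      fix v assume v: "v \<in> ?U"
      have "v = (\<Sum>i\<in>UNIV. v $ i *s fgst_basis i)" by (simp add: basis_expansion)
      also have "\<dots> = (\<Sum>i\<in>set is. v $ i *s fgst_basis i)"
        using v by (intro sum.mono_neutral_right) auto
      also have "\<dots> \<in> vec.span (fgst_basis ` set is)"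
        by (intro vec.span_sum vec.span_scale vec.span_base) auto
      finally show "v \<in> vec.span (fgst_basis ` set is)" .
    qed
  qed
  ultimately show ?thesis
    using assms by (simp add: basis_of_def distinct_map inj_on_def axis_eq_axis)
qed

lemma basis_of_image:
  assumes "vector_space_pair sv sw" "basis_of sv V bs" "inj f"
    and "\<And>u v. f (u + v) = f u + f v" "\<And>c v. f (sv c v) = sw c (f v)"
  shows "basis_of sw (f ` V) (map f bs)"
proof -
  interpret vector_space_pair sv sw by (rule assms)
  have "Vector_Spaces.linear sv sw f" using assms(4,5) by (simp add: Vector_Spaces.linear_iff vs1.vector_space_axioms vs2.vector_space_axioms)
  then interpret f: Vector_Spaces.linear sv sw f .
  show ?thesis
    using assms(2,3) f.span_image[of "set bs"] f.independent_injective_image[of "set bs"]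
    by (auto simp: basis_of_def distinct_map inj_on_def)
qed

theorem propositionB3:
  fixes \<beta> b :: complex
  assumes \<beta>: "\<beta> ^ 4 = -1"
    and b: "b = \<beta> ^ 2 * exp (2 * complex_of_real pi * \<i> / 3)"
  shows "bij (drinfeld_map \<beta>) \<and>
    (\<forall>z\<in>centre. modular_S \<beta> (modular_S \<beta> z) = z) \<and>
    (\<forall>z\<in>centre. ((modular_S \<beta> \<circ> modular_T \<beta>) ^^ 3) z = z) \<and>
    (\<exists>act V2 V3 \<rho> \<phi> \<kappa>0 \<kappa>1 \<kappa>2.
       SL2Z_rep scaleC (centre :: Q set) act \<and>
       (\<forall>z\<in>centre. act S_mat z = modular_S \<beta> z \<and> act T_mat z = modular_T \<beta> z) \<and>
       SL2Z_rep scaleC V2 act \<and> SL2Z_rep scaleC V3 act \<and> direct_sum_of V2 V3 centre \<and>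
       basis_of scaleC V2 [\<rho>, \<phi>] \<and> basis_of scaleC V3 [\<kappa>0, \<kappa>1, \<kappa>2] \<and>
       modular_S \<beta> \<rho> = (- \<i>) *\<^sub>C \<phi> \<and>
       modular_S \<beta> \<phi> = \<i> *\<^sub>C \<rho> \<and>
       modular_T \<beta> \<rho> = b *\<^sub>C \<rho> \<and>
       modular_T \<beta> \<phi> = b *\<^sub>C (\<phi> - (\<i> / \<beta> ^ 2) *\<^sub>C \<rho>) \<and>
       modular_S \<beta> \<kappa>0 = (1/2) *\<^sub>C (\<kappa>0 - 2 *\<^sub>C \<kappa>1 + \<kappa>2) \<and>
       modular_S \<beta> \<kappa>1 = (1/2) *\<^sub>C (\<kappa>2 - \<kappa>0) \<and>
       modular_S \<beta> \<kappa>2 = (1/2) *\<^sub>C (\<kappa>0 + 2 *\<^sub>C \<kappa>1 + \<kappa>2) \<and>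
       modular_T \<beta> \<kappa>0 = (- b * \<beta>) *\<^sub>C \<kappa>0 \<and>
       modular_T \<beta> \<kappa>1 = b *\<^sub>C \<kappa>1 \<and>
       modular_T \<beta> \<kappa>2 = (b * \<beta>) *\<^sub>C \<kappa>2 \<and>
       (\<beta> = exp (- \<i> * complex_of_real pi / 4) \<longrightarrow>
         (\<exists>act'. fgst_rep act' \<and> SL2Z_rep_equiv scaleC centre act (*s) UNIV act')))"
proof -
  let ?f = "central_iso \<beta>"
  let ?U2 = "{v :: fgst. v $ Kappa0 = 0 \<and> v $ Kappa1 = 0 \<and> v $ Kappa2 = 0}"
  let ?U3 = "{v :: fgst. v $ Rho1 = 0 \<and> v $ Phi1 = 0}"
  have b': "bcoeff \<beta> = b" by (simp add: b bcoeff_def)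
  note S = modular_S_central_iso[OF \<beta>] and T = modular_T_central_iso[OF \<beta>, unfolded b']
  note range = centre_eq_range[OF \<beta>] and inj = inj_central_iso[OF \<beta>]
  have inv: "inv ?f (?f v) = v" for v using inj by (rule inv_f_f)
  obtain act where act: "\<And>v. act S_mat v = S_coord v" "\<And>v. act T_mat v = T_coord \<beta> b v"
    and rep: "SL2Z_rep (*s) UNIV act" "SL2Z_rep (*s) ?U2 act" "SL2Z_rep (*s) ?U3 act"
    by (rule exists_fgst_action[OF \<beta>, unfolded b'], rule that)
  \<comment> \<open>Only values on the centre, the range of \<open>?f\<close>, are meaningful;
    elsewhere \<open>inv\<close> is arbitrary.\<close>
  define act' where "act' = (\<lambda>g z. ?f (act g (inv ?f z)))"
  have transport: "SL2Z_rep scaleC (?f ` U) act'" if "SL2Z_rep (*s) U act" for U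
    unfolding act'_def
    by (rule SL2Z_rep_transport[OF that cvs.vector_space_axioms inj]) (rule central_iso_linear)+
  have pair: "vector_space_pair (*s) (scaleC :: complex \<Rightarrow> Q \<Rightarrow> Q)"
    by (intro vector_space_pair.intro vec.vector_space_axioms cvs.vector_space_axioms)
  have basis: "basis_of scaleC (?f ` V) (map ?f bs)" if "basis_of (*s) V bs" for V bs
    by (rule basis_of_image[OF pair that inj]) (rule central_iso_linear)+
  let ?b = "\<lambda>i. ?f (fgst_basis i)"
  have S_basis: "modular_S \<beta> (?b i) = ?f (fgst_S_basis i)" for i
    by (simp add: S S_coord_basis)
  have diff: "?f (u - v) = ?f u - ?f v" for u v
    using central_iso_linear(1)[of \<beta> "u - v" v] by simp
  have uminus: "?f (- v) = - ?f v" for v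
    using diff[of 0 v] diff[of 0 0] by simp
  have T_basis: "T_coord \<beta> b (fgst_basis Rho1) = b *s fgst_basis Rho1"
    "T_coord \<beta> b (fgst_basis Phi1) = b *s (fgst_basis Phi1 - (\<i> / \<beta>\<^sup>2) *s fgst_basis Rho1)"
    "T_coord \<beta> b (fgst_basis Kappa0) = (- b * \<beta>) *s fgst_basis Kappa0"
    "T_coord \<beta> b (fgst_basis Kappa1) = b *s fgst_basis Kappa1"
    "T_coord \<beta> b (fgst_basis Kappa2) = (b * \<beta>) *s fgst_basis Kappa2"
    by (simp_all add: fgst_eq_iff T_coord_def axis_def)
  show ?thesis
  proof (intro conjI, goal_cases)
    case 1
    show ?case by (rule bij_drinfeld_map[OF \<beta>])
  next
    case 2
    show "\<forall>z\<in>centre. modular_S \<beta> (modular_S \<beta> z) = z"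
      by (auto simp: S S_coord_S_coord simp flip: range)
  next
    case 3
    show "\<forall>z\<in>centre. ((modular_S \<beta> \<circ> modular_T \<beta>) ^^ 3) z = z"
      using S_T_coord_cube[OF \<beta> bcoeff_cube(1)[OF \<beta>]] b'
      by (auto simp: S T numeral_3_eq_3 simp flip: range)
  next
    case 4
    show ?case
    proof (rule exI[of _ act'], rule exI[of _ "?f ` ?U2"], rule exI[of _ "?f ` ?U3"], rule exI[of _ "?b Rho1"],
        rule exI[of _ "?b Phi1"], rule exI[of _ "?b Kappa0"], rule exI[of _ "?b Kappa1"],
        rule exI[of _ "?b Kappa2"], intro conjI)
      show "SL2Z_rep scaleC centre act'" using transport[OF rep(1)] by (simp add: range)
      show "SL2Z_rep scaleC (?f ` ?U2) act'" "SL2Z_rep scaleC (?f ` ?U3) act'"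
        by (rule transport, rule rep)+
      show "\<forall>z\<in>centre. act' S_mat z = modular_S \<beta> z \<and> act' T_mat z = modular_T \<beta> z"
        by (auto simp: act'_def S T act inv simp flip: range)
      show "direct_sum_of (?f ` ?U2) (?f ` ?U3) centre"
        unfolding direct_sum_of_def
      proof
        have "?U2 \<inter> ?U3 = {0}" by (auto simp: fgst_eq_iff)
        then show "?f ` ?U2 \<inter> ?f ` ?U3 = {0}" using diff[of 0 0] by (simp flip: image_Int[OF inj])
        have "z \<in> {v + w |v w. v \<in> ?f ` ?U2 \<and> w \<in> ?f ` ?U3}" if "z \<in> centre" for z
        proof -
          obtain v where v: "z = ?f v" using \<open>z \<in> centre\<close> by (auto simp flip: range)
          define w :: fgst where "w = v $ Rho1 *s fgst_basis Rho1 + v $ Phi1 *s fgst_basis Phi1"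
          have "z = ?f w + ?f (v - w)" by (simp add: v diff)
          moreover have "w \<in> ?U2" "v - w \<in> ?U3" by (simp_all add: w_def axis_def)
          ultimately show ?thesis by blast
        qed
        then show "{v + w |v w. v \<in> ?f ` ?U2 \<and> w \<in> ?f ` ?U3} = centre"
          by (auto simp flip: range central_iso_linear(1))
      qed
      have "?U2 = {v. \<forall>i. i \<notin> set [Rho1, Phi1] \<longrightarrow> v $ i = 0}"
        "?U3 = {v. \<forall>i. i \<notin> set [Kappa0, Kappa1, Kappa2] \<longrightarrow> v $ i = 0}"
        by (simp_all add: all_fgst_index)
      then show "basis_of scaleC (?f ` ?U2) [?b Rho1, ?b Phi1]"
        "basis_of scaleC (?f ` ?U3) [?b Kappa0, ?b Kappa1, ?b Kappa2]"
        using basis[OF basis_of_coordinate_subspace[of "[Rho1, Phi1]"]]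
          basis[OF basis_of_coordinate_subspace[of "[Kappa0, Kappa1, Kappa2]"]] by simp_all
      show "\<beta> = exp (- \<i> * complex_of_real pi / 4) \<longrightarrow>
           (\<exists>act''. fgst_rep act'' \<and> SL2Z_rep_equiv scaleC centre act' (*s) UNIV act'')"
      proof
        assume "\<beta> = exp (- \<i> * complex_of_real pi / 4)"
        \<comment> \<open>The coordinate action itself serves as the FGST representation, so the
          intertwiner is the inverse of \<open>central_iso\<close>.\<close>
        then have "fgst_rep act"
          using rep(1) T_coord_basis b' by (simp add: fgst_rep_def act S_coord_basis)
        moreover have "SL2Z_rep_equiv scaleC centre act' (*s) UNIV act"
          unfolding SL2Z_rep_equiv_def
        proof (intro exI[of _ "inv ?f"] conjI ballI)
          show "linear_between scaleC centre (*s) UNIV (inv ?f)"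
            by (auto simp: linear_between_def inv simp flip: range central_iso_linear)
          show "bij_betw (inv ?f) centre UNIV"
            unfolding range[symmetric] by (rule bij_betw_inv_into[OF inj_on_imp_bij_betw[OF inj]])
        qed (auto simp: act'_def inv)
        ultimately show "\<exists>act''. fgst_rep act'' \<and> SL2Z_rep_equiv scaleC centre act' (*s) UNIV act''"
          by blast
      qed
    qed (simp_all add: S_basis T T_basis central_iso_linear diff uminus
      cvs.scale_right_diff_distrib scaleC_add_right scaleC_scaleC scaleC_one)
  qed
qed

end
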